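(* Let $G$ be a decomposable reflection group. Then any reflection subgroup $H$ of $G$ is a direct product of reflection subgroups of indecomposable components of $G$.
   Context: A Euclidean reflection group is the discrete group generated by the reflections in the facets of a Coxeter polytope (all dihedral angles integer submultiples of $\pi$) in $\mathbb{E}^n$; a spherical reflection group is a finite group generated by reflections. "Reflection group" means either of these. A reflection subgroup is a subgroup generated by reflections. A reflection group is indecomposable if the Coxeter diagram of its fundamental chamber is connected; every reflection group is the direct product of indecomposable reflection groups (corresponding to the connected components of this diagram), called its components. *)

theory Defs
  imports
    "HOL-Analysis.Analysis"
    "HOL-Algebra.Bij"
    "HOL-Algebra.Generated_Groups"
    "HOL-Algebra.Product_Groups"
begin

section \<open>Reflections and the ambient group\<close>

text \<open>
  Euclidean space of dimension \<open>n\<close> is an arbitrary type of class \<open>euclidean_space\<close>. All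
  transformation groups below are subgroups of the library group of all bijections of that space,
  with composition as the product. As the generators considered are reflections, all of them
  consist of isometries.
\<close>

abbreviation transformations :: "('a \<Rightarrow> 'a) monoid"
  where "transformations \<equiv> BijGroup UNIV"

definition hyperplane_reflection :: "'a::euclidean_space \<Rightarrow> real \<Rightarrow> 'a \<Rightarrow> 'a"
  where "hyperplane_reflection a c x = x - (2 * (a \<bullet> x - c) / (a \<bullet> a)) *\<^sub>R a"

definition is_reflection_in :: "('a::euclidean_space \<Rightarrow> 'a) \<Rightarrow> 'a set \<Rightarrow> bool"
  where "is_reflection_in r M \<longleftrightarrow>
    (\<exists>a c. a \<noteq> 0 \<and> M = {x. a \<bullet> x = c} \<and> r = hyperplane_reflection a c)"

definition is_reflection :: "('a::euclidean_space \<Rightarrow> 'a) \<Rightarrow> bool"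
  where "is_reflection r \<longleftrightarrow> (\<exists>M. is_reflection_in r M)"

definition facet_reflections :: "'a::euclidean_space set set \<Rightarrow> ('a \<Rightarrow> 'a) set"
  where "facet_reflections \<F> = {r. \<exists>F\<in>\<F>. is_reflection_in r (affine hull F)}"

definition generated_by_reflections :: "('a::euclidean_space \<Rightarrow> 'a) set \<Rightarrow> bool"
  where "generated_by_reflections G \<longleftrightarrow>
    (\<exists>R. (\<forall>r\<in>R. is_reflection r) \<and> G = generate transformations R)"

definition reflection_subgroup ::
    "('a::euclidean_space \<Rightarrow> 'a) set \<Rightarrow> ('a \<Rightarrow> 'a) set \<Rightarrow> bool"
  where "reflection_subgroup H G \<longleftrightarrow>
    subgroup H transformations \<and> H \<subseteq> G \<and> generated_by_reflections H"


section \<open>Coxeter polytopes\<close>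

definition facets :: "'a::euclidean_space set \<Rightarrow> 'a set set"
  where "facets P = {F. F facet_of P}"

text \<open>For \<open>P\<close> convex with nonempty interior and \<open>F\<close> a facet, such a vector exists and is unique.\<close>

definition outward_normal :: "'a::euclidean_space set \<Rightarrow> 'a set \<Rightarrow> 'a"
  where "outward_normal P F =
    (THE a. norm a = 1 \<and> (\<exists>c. P \<subseteq> {x. a \<bullet> x \<le> c} \<and> F = P \<inter> {x. a \<bullet> x = c}))"

text \<open>
  Two facets form a dihedral angle if they meet in a face of codimension two. Nonemptiness is a
  separate requirement because \<open>aff_dim {} = - 1\<close>, which is codimension two in dimension one.
\<close>

definition adjacent_facets :: "'a::euclidean_space set \<Rightarrow> 'a set \<Rightarrow> 'a set \<Rightarrow> bool"
  where "adjacent_facets P F F' \<longleftrightarrow>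
    F facet_of P \<and> F' facet_of P \<and> F \<inter> F' \<noteq> {} \<and> aff_dim (F \<inter> F') = aff_dim P - 2"

text \<open>The interior angle is supplementary to the angle of the outward normals.\<close>

definition dihedral_angle :: "'a::euclidean_space set \<Rightarrow> 'a set \<Rightarrow> 'a set \<Rightarrow> real"
  where "dihedral_angle P F F' = pi - arccos (outward_normal P F \<bullet> outward_normal P F')"

text \<open>
  A polytope is an intersection of finitely many half-spaces with nonempty interior;
  it need not be bounded.
\<close>

definition coxeter_polytope :: "'a::euclidean_space set \<Rightarrow> bool"
  where "coxeter_polytope P \<longleftrightarrow>
    polyhedron P \<and> interior P \<noteq> {} \<and>
    (\<forall>F F'. adjacent_facets P F F' \<longrightarrow> (\<exists>m::nat. m > 0 \<and> dihedral_angle P F F' = pi / real m))"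


section \<open>Reflection groups\<close>

text \<open>
  The identity is isolated in the compact-open topology: it has a basic neighbourhood that
  contains no other element of the group.
\<close>

definition discrete_group :: "('a::euclidean_space \<Rightarrow> 'a) set \<Rightarrow> bool"
  where "discrete_group G \<longleftrightarrow>
    (\<exists>K \<epsilon>. compact K \<and> \<epsilon> > 0 \<and> (\<forall>g\<in>G. (\<forall>x\<in>K. dist (g x) x < \<epsilon>) \<longrightarrow> g = id))"

definition euclidean_reflection_group :: "('a::euclidean_space \<Rightarrow> 'a) set \<Rightarrow> bool"
  where "euclidean_reflection_group G \<longleftrightarrow>
    discrete_group G \<and>
    (\<exists>P. coxeter_polytope P \<and> G = generate transformations (facet_reflections (facets P)))"

text \<open>
  The mirrors of a finite group have a common point, the group acts on the spheres centred
  there, and its spherical chambers are the sections of the conical chambers by these spheres.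
  The common point is not required to be the origin.
\<close>

definition spherical_reflection_group :: "('a::euclidean_space \<Rightarrow> 'a) set \<Rightarrow> bool"
  where "spherical_reflection_group G \<longleftrightarrow> finite G \<and> generated_by_reflections G"

definition reflection_group :: "('a::euclidean_space \<Rightarrow> 'a) set \<Rightarrow> bool"
  where "reflection_group G \<longleftrightarrow> euclidean_reflection_group G \<or> spherical_reflection_group G"


section \<open>Fundamental chamber, Coxeter diagram and components\<close>

definition mirrors :: "('a::euclidean_space \<Rightarrow> 'a) set \<Rightarrow> 'a set set"
  where "mirrors G = {M. \<exists>r\<in>G. is_reflection_in r M}"

definition fundamental_chamber ::
    "('a::euclidean_space \<Rightarrow> 'a) set \<Rightarrow> 'a set \<Rightarrow> bool"
  where "fundamental_chamber G D \<longleftrightarrow> (\<exists>C \<in> components (- \<Union>(mirrors G)). D = closure C)"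

text \<open>
  The nodes of the Coxeter diagram are the facets of the chamber. Two nodes are not joined
  exactly if the facets are orthogonal; in particular, parallel facets are joined. The labels of
  the edges are irrelevant for connectedness.
\<close>

definition coxeter_edges :: "'a::euclidean_space set \<Rightarrow> ('a set \<times> 'a set) set"
  where "coxeter_edges D = {(F, F'). F \<in> facets D \<and> F' \<in> facets D \<and> F \<noteq> F' \<and>
    \<not> (adjacent_facets D F F' \<and> dihedral_angle D F F' = pi / 2)}"

definition coxeter_diagram_connected :: "'a::euclidean_space set \<Rightarrow> bool"
  where "coxeter_diagram_connected D \<longleftrightarrow>
    (\<forall>F\<in>facets D. \<forall>F'\<in>facets D. (F, F') \<in> (coxeter_edges D)\<^sup>*)"

definition diagram_components :: "'a::euclidean_space set \<Rightarrow> 'a set set set"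
  where "diagram_components D = facets D // (coxeter_edges D)\<^sup>*"

definition indecomposable :: "('a::euclidean_space \<Rightarrow> 'a) set \<Rightarrow> bool"
  where "indecomposable G \<longleftrightarrow>
    (\<forall>D. fundamental_chamber G D \<longrightarrow> coxeter_diagram_connected D)"

text \<open>The component of the group that belongs to a connected component of the diagram.\<close>

definition component_group :: "'a::euclidean_space set set \<Rightarrow> ('a \<Rightarrow> 'a) set"
  where "component_group \<F> = generate transformations (facet_reflections \<F>)"


section \<open>Direct products\<close>

text \<open>
  \<open>H\<close> is the (internal) direct product of its subgroups \<open>K i\<close>: the inclusions of the factors
  extend to an isomorphism from the external direct product. This is meant for finite index
  sets, for which such an isomorphism is unique.
\<close>

definition direct_product_of ::
    "('g, 'x) monoid_scheme \<Rightarrow> 'g set \<Rightarrow> 'i set \<Rightarrow> ('i \<Rightarrow> 'g set) \<Rightarrow> bool"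
  where "direct_product_of B H I K \<longleftrightarrow>
    (\<exists>\<phi> \<in> iso (product_group I (\<lambda>i. B\<lparr>carrier := K i\<rparr>)) (B\<lparr>carrier := H\<rparr>).
      \<forall>i\<in>I. \<forall>x\<in>K i. \<phi> (\<lambda>j\<in>I. if j = i then x else \<one>\<^bsub>B\<^esub>) = x)"

end

theory Submission
  imports Defs
begin

text \<open>
  Facets of the chamber \<open>D\<close> in different components of the diagram have orthogonal normals, so
  the component groups move points within pairwise orthogonal subspaces; they commute, and their
  displacements add up. The crux is that every reflection \<open>r\<close> of \<open>G\<close> lies in a single component
  group. Join a point \<open>x\<close> of the open chamber to a point beyond the mirror of \<open>r\<close> by a segment
  that meets the mirrors one at a time, and induct on the number of mirrors it meets. The first
  mirror met spans a facet of \<open>D\<close>, with reflection \<open>s\<close>. If \<open>s \<noteq> r\<close>, applying \<open>s\<close> to the rest of the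
  segment gives an instance with fewer mirrors, so \<open>s r s\<close> lies in a component group, and then so does \<open>r\<close>
  whether or not that component contains the facet of \<open>s\<close>.
\<close>

text \<open>A subgroup of a direct product need not split along the factors. What saves a reflection
  subgroup is that each of its generating reflections lies in one factor: the generators can then be
  sorted by component, and the groups generated by the sorted parts commute and together generate
  \<open>H\<close>.

  The obstacle is a point where the segment meets several mirrors at once. It may lie on a face of
  \<open>D\<close> of codimension two or more and then singles out no facet. Hence the segment must
  be generic. For a fixed end \<open>y\<close> off the mirrors and two distinct mirrors, the starts
  whose segment to \<open>y\<close> passes through a common point of both lie in a hyperplane. There
  are countably many pairs of mirrors and the chamber is open, so a good start exists inside it.

  Finite and discrete groups are treated alike through one property: only finitely many mirrors meet
  a compact set. It gives the countability, a first mirror on a segment, and a finite number of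
  crossings on which to induct.\<close>

section \<open>Hyperplane reflections and their mirrors\<close>

lemma hyperplane_reflection_involutive:
  assumes "a \<noteq> 0"
  shows "hyperplane_reflection a c (hyperplane_reflection a c x) = x"
proof -
  have "a \<bullet> hyperplane_reflection a c x - c = - (a \<bullet> x - c)"
    using assms by (simp add: hyperplane_reflection_def inner_diff_right)
  then have "2 * (a \<bullet> hyperplane_reflection a c x - c) / (a \<bullet> a)
      = - (2 * (a \<bullet> x - c) / (a \<bullet> a))"
    by (simp only: mult_minus_right minus_divide_left)
  then show ?thesis
    unfolding hyperplane_reflection_def by simp
qed

lemma hyperplane_reflection_fixed_iff:
  assumes "a \<noteq> 0"
  shows "hyperplane_reflection a c x = x \<longleftrightarrow> a \<bullet> x = c"
  using assms by (simp add: hyperplane_reflection_def)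

lemma hyperplane_reflection_inner_self:
  assumes "a \<noteq> 0"
  shows "a \<bullet> hyperplane_reflection a c x = 2 * c - a \<bullet> x"
  using assms by (simp add: hyperplane_reflection_def inner_diff_right)

lemma hyperplane_reflection_diff:
  "hyperplane_reflection a c x - hyperplane_reflection a c y
     = (x - y) - (2 * (a \<bullet> (x - y)) / (a \<bullet> a)) *\<^sub>R a"
proof -
  have "2 * (a \<bullet> (x - y)) / (a \<bullet> a)
      = 2 * (a \<bullet> x - c) / (a \<bullet> a) - 2 * (a \<bullet> y - c) / (a \<bullet> a)"
    by (simp add: inner_diff_right algebra_simps diff_divide_distrib)
  then show ?thesis
    by (simp add: hyperplane_reflection_def scaleR_left_diff_distrib)
qed

lemma norm_linear_reflection:
  fixes a v :: "'a::euclidean_space"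
  assumes "a \<noteq> 0"
  shows "norm (v - (2 * (a \<bullet> v) / (a \<bullet> a)) *\<^sub>R a) = norm v"
proof -
  have "(v - (2 * (a \<bullet> v) / (a \<bullet> a)) *\<^sub>R a) \<bullet> (v - (2 * (a \<bullet> v) / (a \<bullet> a)) *\<^sub>R a) = v \<bullet> v"
    using assms by (simp add: inner_diff_left inner_diff_right inner_commute algebra_simps)
  then show ?thesis
    by (simp add: norm_eq_sqrt_inner)
qed

lemma dist_hyperplane_reflection:
  assumes "a \<noteq> 0"
  shows "dist (hyperplane_reflection a c x) (hyperplane_reflection a c y) = dist x y"
  using norm_linear_reflection[OF assms, of "x - y"]
  by (simp add: dist_norm hyperplane_reflection_diff)

lemma hyperplane_reflection_scale:
  assumes "k \<noteq> 0"
  shows "hyperplane_reflection (k *\<^sub>R a) (k * c) = hyperplane_reflection a c"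
  using assms
  by (auto simp: fun_eq_iff hyperplane_reflection_def power2_eq_square field_simps
      simp flip: right_diff_distrib)

text \<open>Here \<open>p\<close> is the foot of the perpendicular from the origin and
  \<open>v\<close> the part of \<open>b\<close> orthogonal to \<open>a\<close>. Moving from
  \<open>p\<close> by \<open>v\<close> stays on the hyperplane, so \<open>b \<bullet> v = 0\<close>,
  which forces \<open>v = 0\<close>.\<close>

lemma hyperplane_eq_imp_proportional:
  fixes a b :: "'a::euclidean_space"
  assumes "a \<noteq> 0" "b \<noteq> 0" and eq: "{x. a \<bullet> x = c} = {x. b \<bullet> x = d}"
  obtains k where "k \<noteq> 0" "b = k *\<^sub>R a" "d = k * c"
proof -
  define p where "p = (c / (a \<bullet> a)) *\<^sub>R a"
  define k where "k = (a \<bullet> b) / (a \<bullet> a)"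
  define v where "v = b - k *\<^sub>R a"
  have p: "a \<bullet> p = c" and av: "a \<bullet> v = 0"
    using assms(1) by (simp_all add: p_def k_def v_def inner_diff_right)
  then have "a \<bullet> (p + v) = c"
    by (simp add: inner_add_right)
  with p eq have bp: "b \<bullet> p = d" and "b \<bullet> (p + v) = d"
    by blast+
  then have "b \<bullet> v = 0"
    by (simp add: inner_add_right)
  with av have "v \<bullet> v = 0"
    by (simp add: v_def inner_diff_left)
  then have b: "b = k *\<^sub>R a"
    by (simp add: v_def)
  with bp p have "d = k * c"
    by simp
  with b assms(2) that show thesis
    by force
qed

lemma is_reflection_in_obtain_unit:
  assumes "is_reflection_in r M"
  obtains a c where "norm a = 1" "M = {x. a \<bullet> x = c}" "r = hyperplane_reflection a c"
proof -
  obtain a c where a: "a \<noteq> 0" "M = {x. a \<bullet> x = c}" "r = hyperplane_reflection a c"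
    using assms by (auto simp: is_reflection_in_def)
  let ?k = "1 / norm a"
  have "norm (?k *\<^sub>R a) = 1" "M = {x. (?k *\<^sub>R a) \<bullet> x = ?k * c}"
    "r = hyperplane_reflection (?k *\<^sub>R a) (?k * c)"
    using a hyperplane_reflection_scale[of ?k a c] by auto
  then show thesis
    by (rule that)
qed

lemma is_reflection_in_fixed_points:
  assumes "is_reflection_in r M"
  shows "M = {x. r x = x}"
  using assms by (auto simp: is_reflection_in_def hyperplane_reflection_fixed_iff)

lemma is_reflection_in_unique:
  assumes "is_reflection_in r M" "is_reflection_in s M"
  shows "r = s"
proof -
  obtain a c where a: "a \<noteq> 0" "M = {x. a \<bullet> x = c}" "r = hyperplane_reflection a c"
    using assms(1) unfolding is_reflection_in_def by blast
  obtain b d where b: "b \<noteq> 0" "M = {x. b \<bullet> x = d}" "s = hyperplane_reflection b d"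
    using assms(2) unfolding is_reflection_in_def by blast
  obtain k where "k \<noteq> 0" "b = k *\<^sub>R a" "d = k * c"
    using hyperplane_eq_imp_proportional[of a b c d] a b by metis
  with a b show ?thesis
    by (simp add: hyperplane_reflection_scale)
qed

lemma is_reflection_obtain:
  assumes "is_reflection r"
  obtains a c where "a \<noteq> 0" "r = hyperplane_reflection a c"
  using assms by (auto simp: is_reflection_def is_reflection_in_def)

lemma is_reflection_hyperplane_reflection:
  "a \<noteq> 0 \<Longrightarrow> is_reflection (hyperplane_reflection a c)"
  by (auto simp: is_reflection_def is_reflection_in_def)

lemma is_reflection_in_fixed:
  assumes "is_reflection r"
  shows "is_reflection_in r {x. r x = x}"
  using assms is_reflection_in_fixed_points by (metis is_reflection_def)

lemma is_reflection_involutive: "is_reflection r \<Longrightarrow> r (r x) = x"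
  by (metis is_reflection_obtain hyperplane_reflection_involutive)

lemma is_reflection_comp_self: "is_reflection r \<Longrightarrow> r \<circ> r = id"
  by (simp add: fun_eq_iff is_reflection_involutive)

lemma is_reflection_conjugate_twice: "is_reflection s \<Longrightarrow> s \<circ> (s \<circ> r \<circ> s) \<circ> s = r"
  by (simp add: fun_eq_iff is_reflection_involutive)

lemma bij_is_reflection: "is_reflection r \<Longrightarrow> bij r"
  by (metis is_reflection_comp_self o_bij)

lemma dist_is_reflection: "is_reflection r \<Longrightarrow> dist (r x) (r y) = dist x y"
  by (metis is_reflection_obtain dist_hyperplane_reflection)

lemma is_reflection_affine_combination:
  assumes "is_reflection r"
  shows "r ((1 - t) *\<^sub>R x + t *\<^sub>R y) = (1 - t) *\<^sub>R r x + t *\<^sub>R r y"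
proof -
  obtain a c where r: "r = hyperplane_reflection a c"
    using assms by (rule is_reflection_obtain)
  let ?z = "(1 - t) *\<^sub>R x + t *\<^sub>R y"
  have "2 * (a \<bullet> ?z - c) / (a \<bullet> a)
      = (1 - t) * (2 * (a \<bullet> x - c) / (a \<bullet> a)) + t * (2 * (a \<bullet> y - c) / (a \<bullet> a))"
    by (simp add: inner_add_right add_divide_distrib diff_divide_distrib algebra_simps)
  then show ?thesis
    unfolding r hyperplane_reflection_def by (simp add: algebra_simps)
qed

lemma closed_segment_is_reflection:
  assumes "is_reflection r"
  shows "closed_segment (r x) (r y) = r ` closed_segment x y"
  unfolding closed_segment_def
  by (auto simp: is_reflection_affine_combination[OF assms, symmetric])

text \<open>The mirror of the conjugate is the image under \<open>s\<close> of the mirror of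
  \<open>r\<close>. Its normal \<open>a'\<close> is the image of \<open>a\<close> under the linear
  part of \<open>s\<close>; the shift \<open>k * e\<close> of the offset comes from the translation
  part of \<open>s\<close>.\<close>

lemma is_reflection_conjugate:
  assumes "is_reflection s" "is_reflection r"
  shows "is_reflection (s \<circ> r \<circ> s)"
proof -
  obtain b e where b: "b \<noteq> 0" "s = hyperplane_reflection b e"
    using assms(1) by (rule is_reflection_obtain)
  obtain a c where a: "a \<noteq> 0" "r = hyperplane_reflection a c"
    using assms(2) by (rule is_reflection_obtain)
  define k where "k = 2 * (b \<bullet> a) / (b \<bullet> b)"
  define a' where "a' = a - k *\<^sub>R b"
  have na: "norm a' = norm a"
    unfolding a'_def k_def by (rule norm_linear_reflection[OF b(1)])
  then have aa: "a' \<bullet> a' = a \<bullet> a"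
    by (simp add: norm_eq_sqrt_inner)
  have s: "s (y - l *\<^sub>R a) = s y - l *\<^sub>R a'" for y l
  proof -
    have "s y - s (y - l *\<^sub>R a) = l *\<^sub>R a - (2 * (b \<bullet> (l *\<^sub>R a)) / (b \<bullet> b)) *\<^sub>R b"
      unfolding b(2) hyperplane_reflection_diff by simp
    also have "\<dots> = l *\<^sub>R a'"
      by (simp add: a'_def k_def algebra_simps)
    finally show ?thesis
      by (simp add: algebra_simps)
  qed
  have i: "a \<bullet> s x - c = a' \<bullet> x - (c - k * e)" for x
    using b(1) by (simp add: b(2) hyperplane_reflection_def a'_def k_def inner_diff_left
        inner_diff_right inner_commute field_simps)
  have "s (r (s x)) = hyperplane_reflection a' (c - k * e) x" for x
    using is_reflection_involutive[OF assms(1)]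
    by (simp add: a(2) hyperplane_reflection_def s i aa)
  then have "s \<circ> r \<circ> s = hyperplane_reflection a' (c - k * e)"
    by (simp add: fun_eq_iff)
  moreover have "a' \<noteq> 0"
    using na a(1) by auto
  ultimately show ?thesis
    by (simp add: is_reflection_hyperplane_reflection)
qed

subsection \<open>The group of transformations\<close>

lemma carrier_transformations [simp]: "f \<in> carrier transformations \<longleftrightarrow> bij f"
  by (auto simp: BijGroup_def Bij_def extensional_def)

lemma one_transformations [simp]: "\<one>\<^bsub>transformations\<^esub> = id"
  by (auto simp: BijGroup_def)

lemma mult_transformations [simp]:
  "bij f \<Longrightarrow> bij g \<Longrightarrow> f \<otimes>\<^bsub>transformations\<^esub> g = f \<circ> g"
  by (auto simp: BijGroup_def Bij_def extensional_def compose_def fun_eq_iff)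

lemma group_transformations: "group transformations"
  by (rule group_BijGroup)

lemma inv_transformations:
  assumes "bij f"
  shows "inv\<^bsub>transformations\<^esub> f = Hilbert_Choice.inv f"
proof (rule group.inv_equality[OF group_transformations])
  show "Hilbert_Choice.inv f \<otimes>\<^bsub>transformations\<^esub> f = \<one>\<^bsub>transformations\<^esub>"
    using assms by (simp add: bij_imp_bij_inv bij_is_inj)
qed (use assms in \<open>simp_all add: bij_imp_bij_inv\<close>)

lemma subgroup_transformations_bij: "subgroup G transformations \<Longrightarrow> g \<in> G \<Longrightarrow> bij g"
  by (metis carrier_transformations subgroup.mem_carrier)

lemma subgroup_transformations_comp:
  assumes "subgroup G transformations" "g \<in> G" "h \<in> G"
  shows "g \<circ> h \<in> G"
  using subgroup.m_closed[OF assms] subgroup_transformations_bij[OF assms(1)] assms(2,3) by simp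

lemma subgroup_transformations_id: "subgroup G transformations \<Longrightarrow> id \<in> G"
  by (metis one_transformations subgroup.one_closed)

lemma subgroup_generate_reflections:
  assumes "\<And>r. r \<in> R \<Longrightarrow> is_reflection r"
  shows "subgroup (generate transformations R) transformations"
  using assms by (intro group.generate_is_subgroup[OF group_transformations])
    (auto simp: bij_is_reflection)

section \<open>Discreteness makes the mirrors locally finite\<close>

lemma discrete_group_locally_finite_reflections:
  assumes G: "subgroup G transformations" and "discrete_group G" and "compact K"
  shows "finite {r \<in> G. is_reflection r \<and> (\<exists>z\<in>K. r z = z)}"
proof (rule ccontr)
  \<comment> \<open>Mirrors \<open>a \<bullet> x = c\<close> meeting \<open>K\<close> have parameters \<open>(a, c)\<close> in a compact set, so two of them nearly
    agree, and the product of their reflections is too close to the identity.\<close>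
  define S where "S = {r \<in> G. is_reflection r \<and> (\<exists>z\<in>K. r z = z)}"
  assume "infinite {r \<in> G. is_reflection r \<and> (\<exists>z\<in>K. r z = z)}"
  then have inf: "infinite S"
    by (simp add: S_def)
  obtain L \<epsilon> where "compact L" "\<epsilon> > 0"
    and L: "\<And>g. g \<in> G \<Longrightarrow> \<forall>x\<in>L. dist (g x) x < \<epsilon> \<Longrightarrow> g = id"
    using assms(2) unfolding discrete_group_def by blast
  then have "bounded (K \<union> L)"
    using assms(3) by (simp add: compact_imp_bounded)
  then obtain B where "B > 0" and B: "\<And>x. x \<in> K \<union> L \<Longrightarrow> norm x \<le> B"
    by (meson bounded_pos)
  have "\<forall>r\<in>S. \<exists>a c. norm a = 1 \<and> r = hyperplane_reflection a c"
    unfolding S_def is_reflection_def by (blast elim: is_reflection_in_obtain_unit)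
  then obtain A c where A: "\<And>r. r \<in> S \<Longrightarrow> norm (A r) = 1"
    and r_eq: "\<And>r. r \<in> S \<Longrightarrow> r = hyperplane_reflection (A r) (c r)"
    by metis
  define f where "f r = (A r, c r)" for r
  have inj: "inj_on f S"
    by (rule inj_onI) (metis Pair_inject f_def r_eq)
  have "\<bar>c r\<bar> \<le> B" if rS: "r \<in> S" for r
  proof -
    obtain z where z: "z \<in> K" "r z = z"
      using rS by (auto simp: S_def)
    have "A r \<noteq> 0"
      using A[OF rS] by auto
    with z r_eq[OF rS] have "A r \<bullet> z = c r"
      by (metis hyperplane_reflection_fixed_iff)
    with Cauchy_Schwarz_ineq2[of "A r" z] A[OF rS] B[of z] z show ?thesis
      by simp
  qed
  then have "f ` S \<subseteq> sphere 0 1 \<times> cball 0 B"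
    using A by (auto simp: f_def)
  moreover have "compact (sphere (0::'a) 1 \<times> cball (0::real) B)"
    by (intro compact_Times compact_sphere compact_cball)
  moreover have "infinite (f ` S)"
    using inf inj by (simp add: finite_image_iff)
  ultimately obtain p where p: "p islimpt f ` S"
    by (meson Heine_Borel_imp_Bolzano_Weierstrass)
  \<comment> \<open>The estimate of \<open>norm (s x - r x)\<close> below comes to
    \<open>\<delta> * (12 * B + 4)\<close>; the larger summand \<open>8\<close> makes it strictly
    less than \<open>\<epsilon>\<close>.\<close>
  define \<delta> where "\<delta> = \<epsilon> / (12 * B + 8)"
  have \<delta>: "\<delta> > 0" "\<delta> * (12 * B + 8) = \<epsilon>"
    using \<open>\<epsilon> > 0\<close> \<open>B > 0\<close> by (simp_all add: \<delta>_def)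
  have "infinite (f ` S \<inter> ball p \<delta>)"
    using p \<delta>(1) by (simp add: islimpt_eq_infinite_ball)
  then obtain u where u: "u \<in> f ` S \<inter> ball p \<delta>"
    by (metis equals0I finite.emptyI)
  have "infinite (f ` S \<inter> ball p \<delta> - {u})"
    using \<open>infinite (f ` S \<inter> ball p \<delta>)\<close> by simp
  then obtain v where v: "v \<in> f ` S \<inter> ball p \<delta>" "v \<noteq> u"
    by (metis DiffD1 DiffD2 equals0I finite.emptyI insertI1)
  obtain r where r: "r \<in> S" "u = f r"
    using u by blast
  obtain s where s: "s \<in> S" "v = f s"
    using v by blast
  define a where "a = A r"
  define b where "b = A s"
  have "dist u v < 2 * \<delta>"
    using u v dist_triangle2[of u v p] by (auto simp: dist_commute)
  then have ab: "norm (a - b) < 2 * \<delta>" and cd: "\<bar>c r - c s\<bar> < 2 * \<delta>"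
    using dist_fst_le[of u v] dist_snd_le[of u v]
    by (auto simp: r s f_def a_def b_def dist_norm)
  have close: "dist (r x) (s x) < \<epsilon>" if "x \<in> L" for x
  proof -
    have x: "norm x \<le> B"
      using B that by blast
    have n: "norm a = 1" "norm b = 1"
      using A r s by (simp_all add: a_def b_def)
    then have 1: "a \<bullet> a = 1" "b \<bullet> b = 1"
      by (simp_all add: norm_eq_1)
    have cs: "\<bar>c s\<bar> \<le> B"
      by (rule \<open>\<And>r. r \<in> S \<Longrightarrow> \<bar>c r\<bar> \<le> B\<close>[OF s(1)])
    have r': "r x = x - (2 * (a \<bullet> x - c r)) *\<^sub>R a"
      using fun_cong[OF r_eq[OF r(1)], of x] 1 by (simp only: a_def hyperplane_reflection_def) simp
    have s': "s x = x - (2 * (b \<bullet> x - c s)) *\<^sub>R b"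
      using fun_cong[OF r_eq[OF s(1)], of x] 1 by (simp only: b_def hyperplane_reflection_def) simp
    have "s x - r x = 2 *\<^sub>R (((a - b) \<bullet> x - (c r - c s)) *\<^sub>R a + (b \<bullet> x - c s) *\<^sub>R (a - b))"
      by (simp add: r' s' algebra_simps inner_diff_left)
    then have "norm (s x - r x)
        = 2 * norm (((a - b) \<bullet> x - (c r - c s)) *\<^sub>R a + (b \<bullet> x - c s) *\<^sub>R (a - b))"
      by simp
    also have "\<dots>
        \<le> 2 * (norm (((a - b) \<bullet> x - (c r - c s)) *\<^sub>R a) + norm ((b \<bullet> x - c s) *\<^sub>R (a - b)))"
      by (intro mult_left_mono norm_triangle_ineq) simp
    also have "\<dots> = 2 * (\<bar>(a - b) \<bullet> x - (c r - c s)\<bar> + \<bar>b \<bullet> x - c s\<bar> * norm (a - b))"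
      using n by simp
    also have "\<dots> \<le> 2 * ((2 * \<delta> * B + 2 * \<delta>) + (2 * B) * (2 * \<delta>))"
    proof -
      have "\<bar>(a - b) \<bullet> x\<bar> \<le> norm (a - b) * norm x"
        by (rule Cauchy_Schwarz_ineq2)
      also have "\<dots> \<le> 2 * \<delta> * B"
        using ab x \<delta>(1) by (intro mult_mono) auto
      finally have "\<bar>(a - b) \<bullet> x - (c r - c s)\<bar> \<le> 2 * \<delta> * B + 2 * \<delta>"
        using cd by linarith
      moreover have "\<bar>b \<bullet> x - c s\<bar> \<le> 2 * B"
        using Cauchy_Schwarz_ineq2[of b x] n x cs by simp
      then have "\<bar>b \<bullet> x - c s\<bar> * norm (a - b) \<le> (2 * B) * (2 * \<delta>)"
        using ab \<open>B > 0\<close> by (intro mult_mono) auto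
      ultimately show ?thesis
        by (intro mult_left_mono add_mono) simp_all
    qed
    also have "\<dots> < \<epsilon>"
      using \<delta> by (simp add: algebra_simps)
    finally show ?thesis
      by (simp add: dist_norm norm_minus_commute)
  qed
  have refl: "is_reflection r" "is_reflection s" "r \<in> G" "s \<in> G"
    using r s by (auto simp: S_def)
  \<comment> \<open>As \<open>r\<close> is an involutive isometry, \<open>r (s x)\<close> is as far
    from \<open>x\<close> as \<open>s x\<close> is from \<open>r x\<close>.\<close>
  have "dist ((r \<circ> s) x) x < \<epsilon>" if "x \<in> L" for x
    using close[OF that] dist_is_reflection[OF refl(1), of "s x" "r x"]
      is_reflection_involutive[OF refl(1), of x]
    by (simp add: dist_commute)
  then have "r \<circ> s = id"
    using L[of "r \<circ> s"] subgroup_transformations_comp[OF G] refl by blast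
  have "r x = s x" for x
    using fun_cong[OF \<open>r \<circ> s = id\<close>, of "s x"] is_reflection_involutive[OF refl(2), of x] by simp
  then have "r = s" ..
  with r s v show False
    by simp
qed

subsection \<open>Locally finite arrangements of mirrors\<close>

text \<open>Mirrors are represented by their reflections: the mirror is the fixed point set and
  determines the reflection, so incidence and counting of mirrors become statements about fixed
  points.\<close>

locale reflection_arrangement =
  fixes R :: "('a::euclidean_space \<Rightarrow> 'a) set"
  assumes reflection: "r \<in> R \<Longrightarrow> is_reflection r"
    and conjugate: "r \<in> R \<Longrightarrow> s \<in> R \<Longrightarrow> s \<circ> r \<circ> s \<in> R"
    and locally_finite: "compact K \<Longrightarrow> finite {r \<in> R. \<exists>z\<in>K. r z = z}"
begin

definition regular_points :: "'a set"
  where "regular_points = {x. \<forall>r\<in>R. r x \<noteq> x}"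

lemma conjugate_image_fixed_iff:
  assumes "s \<in> R"
  shows "(s \<circ> r \<circ> s) (s x) = s x \<longleftrightarrow> r x = x"
  using is_reflection_involutive[OF reflection[OF assms]] by (metis comp_apply)

lemma closed_fixed_points:
  assumes "r \<in> R"
  shows "closed {x. r x = x}"
proof -
  obtain a c where "a \<noteq> 0" "r = hyperplane_reflection a c"
    using reflection[OF assms] by (rule is_reflection_obtain)
  then show ?thesis
    by (simp add: hyperplane_reflection_fixed_iff closed_hyperplane)
qed

text \<open>Only finitely many mirrors meet the unit ball around \<open>q\<close>, so those among
  them that miss \<open>q\<close> have a closed union \<open>T\<close>, and a small ball around
  \<open>q\<close> avoids it.\<close>

lemma nearby_fixing_reflections:
  obtains e where "e > 0" "\<And>r z. r \<in> R \<Longrightarrow> z \<in> ball q e \<Longrightarrow> r z = z \<Longrightarrow> r q = q"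
proof -
  define F where "F = {r \<in> R. \<exists>z\<in>cball q 1. r z = z}"
  define T where "T = (\<Union>r\<in>{r \<in> F. r q \<noteq> q}. {x. r x = x})"
  have "finite F"
    unfolding F_def by (rule locally_finite) simp
  then have "closed T"
    unfolding T_def
    by (intro closed_UN ballI closed_fixed_points) (auto simp: F_def intro: rev_finite_subset)
  then have "open (- T \<inter> ball q 1)"
    by (simp add: open_Compl open_Int)
  moreover have "q \<in> - T \<inter> ball q 1"
    by (simp add: T_def)
  ultimately obtain e where "e > 0" and e: "ball q e \<subseteq> - T \<inter> ball q 1"
    by (meson open_contains_ball)
  have "r q = q" if "r \<in> R" "z \<in> ball q e" "r z = z" for r z
  proof -
    have "z \<in> cball q 1" "z \<notin> T"
      using e that(2) by auto
    with that show ?thesis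
      by (auto simp: T_def F_def)
  qed
  with \<open>e > 0\<close> show thesis
    by (rule that)
qed

lemma open_regular_points: "open regular_points"
  unfolding open_contains_ball
proof
  fix q
  assume "q \<in> regular_points"
  moreover obtain e where "e > 0" "\<And>r z. r \<in> R \<Longrightarrow> z \<in> ball q e \<Longrightarrow> r z = z \<Longrightarrow> r q = q"
    using nearby_fixing_reflections[of q] by metis
  ultimately show "\<exists>e>0. ball q e \<subseteq> regular_points"
    unfolding regular_points_def by blast
qed

text \<open>Each mirror contains the foot of the perpendicular from the origin, hence meets some
  ball of integer radius, and each such ball meets finitely many mirrors. Countability is what lets
  a union of exceptional sets stay negligible.\<close>

lemma countable_reflections: "countable R"
proof -
  have "R \<subseteq> (\<Union>n::nat. {r \<in> R. \<exists>z\<in>cball 0 (real n). r z = z})"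
  proof
    fix r
    assume "r \<in> R"
    then obtain a c where "a \<noteq> 0" "r = hyperplane_reflection a c"
      using reflection by (meson is_reflection_obtain)
    then have "r ((c / (a \<bullet> a)) *\<^sub>R a) = (c / (a \<bullet> a)) *\<^sub>R a"
      by (simp add: hyperplane_reflection_fixed_iff)
    moreover obtain n :: nat where "norm ((c / (a \<bullet> a)) *\<^sub>R a) \<le> real n"
      using real_arch_simple by blast
    ultimately show "r \<in> (\<Union>n::nat. {r \<in> R. \<exists>z\<in>cball 0 (real n). r z = z})"
      using \<open>r \<in> R\<close> by force
  qed
  then show ?thesis
    by (rule countable_subset)
      (intro countable_UN countable_finite locally_finite compact_cball countableI_type)
qed

lemma negligible_common_fixed_on_segment:
  assumes "r \<in> R" "s \<in> R" "r \<noteq> s" "r y \<noteq> y"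
  shows "negligible {x. \<exists>z\<in>closed_segment x y. r z = z \<and> s z = z}"
proof (cases "{x. \<exists>z\<in>closed_segment x y. r z = z \<and> s z = z} = {}")
  case False
  obtain a c where a: "a \<noteq> 0" "r = hyperplane_reflection a c"
    using reflection[OF assms(1)] by (rule is_reflection_obtain)
  obtain b d where b: "b \<noteq> 0" "s = hyperplane_reflection b d"
    using reflection[OF assms(2)] by (rule is_reflection_obtain)
  define g where "g = a \<bullet> y - c"
  define h where "h = b \<bullet> y - d"
  have "g \<noteq> 0"
    using assms(4) a by (simp add: g_def hyperplane_reflection_fixed_iff)
  \<comment> \<open>If \<open>z\<close> on the segment satisfies both equations, then the values at \<open>x\<close> of \<open>a \<bullet> x - c\<close> and
    \<open>b \<bullet> x - d\<close> are proportional to those at \<open>y\<close>, which are \<open>g\<close> and \<open>h\<close>.\<close>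
  define n where "n = h *\<^sub>R a - g *\<^sub>R b"
  have "n \<noteq> 0"
  proof
    assume "n = 0"
    then have "g *\<^sub>R b = h *\<^sub>R a"
      by (simp add: n_def)
    then have "b = (h / g) *\<^sub>R a"
      using \<open>g \<noteq> 0\<close> by (metis divideR_right scaleR_scaleR divide_inverse_commute)
    \<comment> \<open>With parallel normals and a common point, the two mirrors coincide.\<close>
    obtain z where "a \<bullet> z = c" "b \<bullet> z = d"
      using False a b by (auto simp: hyperplane_reflection_fixed_iff)
    with \<open>b = (h / g) *\<^sub>R a\<close> have "d = (h / g) * c"
      by simp
    moreover have "h / g \<noteq> 0"
      using b(1) \<open>b = (h / g) *\<^sub>R a\<close> by auto
    ultimately have "r = s"
      using a b hyperplane_reflection_scale \<open>b = (h / g) *\<^sub>R a\<close> by metis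
    with assms(3) show False ..
  qed
  moreover have "{x. \<exists>z\<in>closed_segment x y. r z = z \<and> s z = z} \<subseteq> {x. n \<bullet> x = h * c - g * d}"
  proof
    fix x
    assume "x \<in> {x. \<exists>z\<in>closed_segment x y. r z = z \<and> s z = z}"
    then obtain t where "a \<bullet> ((1 - t) *\<^sub>R x + t *\<^sub>R y) = c" "b \<bullet> ((1 - t) *\<^sub>R x + t *\<^sub>R y) = d"
      using a b by (auto simp: closed_segment_def hyperplane_reflection_fixed_iff)
    then have 1: "(1 - t) * (a \<bullet> x - c) + t * g = 0" and 2: "(1 - t) * (b \<bullet> x - d) + t * h = 0"
      by (simp_all add: g_def h_def inner_add_right algebra_simps)
    from 1 have "t \<noteq> 1"
      using \<open>g \<noteq> 0\<close> by auto
    have "(1 - t) * (h * (a \<bullet> x - c) - g * (b \<bullet> x - d))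
        = h * ((1 - t) * (a \<bullet> x - c) + t * g) - g * ((1 - t) * (b \<bullet> x - d) + t * h)"
      by (simp add: algebra_simps)
    then have "h * (a \<bullet> x - c) - g * (b \<bullet> x - d) = 0"
      using 1 2 \<open>t \<noteq> 1\<close> by simp
    then show "x \<in> {x. n \<bullet> x = h * c - g * d}"
      by (simp add: n_def inner_diff_left algebra_simps)
  qed
  ultimately show ?thesis
    using negligible_hyperplane negligible_subset by blast
next
  case True
  then show ?thesis
    by (metis negligible_empty)
qed

text \<open>A nonempty open set is not negligible, so it is not covered by the countably many
  exceptional sets, one for each pair of distinct reflections.\<close>

lemma generic_segment_start:
  assumes "open U" "U \<noteq> {}" "y \<in> regular_points"
  obtains x where "x \<in> U"
    "\<And>r s z. r \<in> R \<Longrightarrow> s \<in> R \<Longrightarrow> z \<in> closed_segment x y \<Longrightarrow> r z = z \<Longrightarrow> s z = z \<Longrightarrow> r = s"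
proof -
  define bad where "bad = (\<lambda>(r, s). {x. \<exists>z\<in>closed_segment x y. r z = z \<and> s z = z})"
  define P where "P = {(r, s) \<in> R \<times> R. r \<noteq> s}"
  have "countable P"
    by (rule countable_subset[of P "R \<times> R"])
      (auto simp: P_def countable_reflections intro: countable_SIGMA)
  moreover have "negligible (bad p)" if "p \<in> P" for p
    using that assms(3)
    by (auto simp: P_def bad_def regular_points_def intro!: negligible_common_fixed_on_segment)
  ultimately have "negligible (\<Union>(bad ` P))"
    by (intro negligible_countable_Union) auto
  moreover have "\<not> negligible U"
    using assms by (simp add: open_not_negligible)
  ultimately obtain x where "x \<in> U" "x \<notin> \<Union>(bad ` P)"
    by (meson negligible_subset subsetI)
  then show thesis
    by (intro that[of x]) (auto simp: bad_def P_def)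
qed

section \<open>Chambers, their walls and the first wall on a segment\<close>

context
  fixes C :: "'a set"
  assumes C: "C \<in> components regular_points"
begin

lemma chamber_regular: "x \<in> C \<Longrightarrow> r \<in> R \<Longrightarrow> r x \<noteq> x"
  using in_components_subset[OF C] by (auto simp: regular_points_def)

lemma chamber_open: "open C"
  using C open_regular_points by (metis open_components)

lemma chamber_nonempty: "C \<noteq> {}"
  using C by (rule in_components_nonempty)

lemma connected_subset_chamber:
  assumes "connected S" "S \<inter> C \<noteq> {}" "\<And>r z. r \<in> R \<Longrightarrow> z \<in> S \<Longrightarrow> r z \<noteq> z"
  shows "S \<subseteq> C"
  using assms by (intro components_maximal[OF C]) (auto simp: regular_points_def)

text \<open>A connected set that misses a hyperplane lies strictly on one side of it; negating
  \<open>a\<close> and \<open>c\<close> if necessary makes this the lower side without changing the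
  reflection.\<close>

lemma chamber_side:
  assumes "r \<in> R"
  obtains a c where "a \<noteq> 0" "r = hyperplane_reflection a c" "\<And>x. x \<in> C \<Longrightarrow> a \<bullet> x < c"
proof -
  obtain a c where a: "a \<noteq> 0" "r = hyperplane_reflection a c"
    using reflection[OF assms] by (rule is_reflection_obtain)
  have neq: "a \<bullet> x \<noteq> c" if "x \<in> C" for x
    using chamber_regular[OF that assms] a by (simp add: hyperplane_reflection_fixed_iff)
  have "connected C"
    using C by (rule in_components_connected)
  then have *: "\<not> (a \<bullet> x \<le> c \<and> c \<le> a \<bullet> y)" if "x \<in> C" "y \<in> C" for x y
    using connected_ivt_hyperplane[of C x y a c] neq that by blast
  show thesis
  proof (cases "\<exists>x\<in>C. a \<bullet> x < c")
    case True
    then have "a \<bullet> x < c" if "x \<in> C" for x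
      using * that by (meson less_imp_le not_le)
    with a show thesis
      by (rule that)
  next
    case False
    have "hyperplane_reflection (- a) (- c) = r"
      using a hyperplane_reflection_scale[of "-1" a c] by simp
    moreover have "(- a) \<bullet> x < - c" if "x \<in> C" for x
      using False neq that by force
    ultimately show thesis
      using a by (intro that[of "- a" "- c"]) auto
  qed
qed

lemma chamber_convex: "convex C"
  unfolding convex_contains_segment
proof (intro ballI)
  fix x y
  assume xy: "x \<in> C" "y \<in> C"
  show "closed_segment x y \<subseteq> C"
  proof (rule connected_subset_chamber)
    fix r z
    assume "r \<in> R" and z: "z \<in> closed_segment x y"
    from \<open>r \<in> R\<close> obtain a c where a: "a \<noteq> 0" "r = hyperplane_reflection a c"
      and side: "\<And>x. x \<in> C \<Longrightarrow> a \<bullet> x < c"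
      using chamber_side by metis
    have "closed_segment x y \<subseteq> {x. a \<bullet> x < c}"
      using side xy by (intro closed_segment_subset convex_halfspace_lt) auto
    with z a show "r z \<noteq> z"
      by (auto simp: hyperplane_reflection_fixed_iff)
  qed (use xy in auto)
qed

text \<open>Near \<open>q\<close> there is no mirror but that of \<open>r\<close>. The half-ball on
  the side of \<open>C\<close> is therefore connected and free of mirror points, and it meets
  \<open>C\<close> because \<open>q\<close> is in the closure.\<close>

lemma chamber_near_wall:
  assumes "r \<in> R" "q \<in> closure C" "r q = q" "\<And>s. s \<in> R \<Longrightarrow> s q = q \<Longrightarrow> s = r"
  obtains a c e where "a \<noteq> 0" "r = hyperplane_reflection a c" "\<And>x. x \<in> C \<Longrightarrow> a \<bullet> x < c"
    "e > 0" "ball q e \<inter> {x. a \<bullet> x < c} \<subseteq> C"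
proof -
  obtain a c where a: "a \<noteq> 0" "r = hyperplane_reflection a c"
    and side: "\<And>x. x \<in> C \<Longrightarrow> a \<bullet> x < c"
    using chamber_side[OF assms(1)] by metis
  obtain e where "e > 0" and e: "\<And>r z. r \<in> R \<Longrightarrow> z \<in> ball q e \<Longrightarrow> r z = z \<Longrightarrow> r q = q"
    using nearby_fixing_reflections[of q] by metis
  obtain y where "y \<in> C" "dist y q < e"
    using assms(2) \<open>e > 0\<close> by (meson closure_approachable)
  have "ball q e \<inter> {x. a \<bullet> x < c} \<subseteq> C"
  proof (rule connected_subset_chamber)
    show "connected (ball q e \<inter> {x. a \<bullet> x < c})"
      by (intro convex_connected convex_Int convex_ball convex_halfspace_lt)
    show "ball q e \<inter> {x. a \<bullet> x < c} \<inter> C \<noteq> {}"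
      using \<open>y \<in> C\<close> \<open>dist y q < e\<close> side by (auto simp: dist_commute)
    show "s z \<noteq> z" if "s \<in> R" "z \<in> ball q e \<inter> {x. a \<bullet> x < c}" for s z
      using that e assms(4) a hyperplane_reflection_fixed_iff by fastforce
  qed
  with a side \<open>e > 0\<close> show thesis
    by (rule that)
qed

text \<open>The face that the mirror cuts out of the closed chamber contains a whole disc of the
  mirror around \<open>q\<close>. So its affine hull is the mirror, and it has codimension
  one.\<close>

lemma wall_facet:
  assumes "r \<in> R" "q \<in> closure C" "r q = q" "\<And>s. s \<in> R \<Longrightarrow> s q = q \<Longrightarrow> s = r"
  obtains F where "F \<in> facets (closure C)" "is_reflection_in r (affine hull F)"
proof -
  obtain a c e where a: "a \<noteq> 0" "r = hyperplane_reflection a c"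
    and side: "\<And>x. x \<in> C \<Longrightarrow> a \<bullet> x < c" and "e > 0"
    and half_ball: "ball q e \<inter> {x. a \<bullet> x < c} \<subseteq> C"
    using chamber_near_wall[OF assms] by metis
  define F where "F = closure C \<inter> {x. a \<bullet> x = c}"
  have "closure C \<subseteq> {x. a \<bullet> x \<le> c}"
    using side by (intro closure_minimal closed_halfspace_le) (auto intro: less_imp_le)
  then have face: "F face_of closure C"
    unfolding F_def using chamber_convex
    by (intro face_of_Int_supporting_hyperplane_le convex_closure) auto
  have "z \<in> closure C" if z: "z \<in> ball q e" "a \<bullet> z = c" for z
    unfolding closure_approachable
  proof (intro allI impI)
    fix \<delta> :: real
    assume "\<delta> > 0"
    \<comment> \<open>Pushing \<open>z\<close> off the mirror by \<open>m\<close> towards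
      \<open>C\<close> must stay within \<open>\<delta>\<close> of \<open>z\<close> and inside the
      ball around \<open>q\<close>; halving makes both bounds strict.\<close>
    define m where "m = min \<delta> (e - dist q z) / 2"
    have m: "m > 0" "m < \<delta>" "m < e - dist q z"
      using \<open>\<delta> > 0\<close> z by (auto simp: m_def min_def)
    define w where "w = z - (m / norm a) *\<^sub>R a"
    have "dist w z = m"
      using m a by (simp add: w_def dist_norm)
    moreover have "a \<bullet> w < c"
      using m a z by (simp add: w_def inner_diff_right)
    moreover have "w \<in> ball q e"
      using dist_triangle[of q w z] m \<open>dist w z = m\<close> by (simp add: dist_commute)
    ultimately show "\<exists>y\<in>C. dist y z < \<delta>"
      using half_ball m by blast
  qed
  then have "{x. a \<bullet> x = c} \<inter> ball q e \<subseteq> F"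
    by (auto simp: F_def)
  moreover have "affine hull ({x. a \<bullet> x = c} \<inter> ball q e) = {x. a \<bullet> x = c}"
  proof -
    have "q \<in> {x. a \<bullet> x = c} \<inter> ball q e"
      using assms(3) a \<open>e > 0\<close> by (simp add: hyperplane_reflection_fixed_iff)
    then show ?thesis
      by (subst affine_hull_affine_Int_open) (auto simp: affine_hyperplane affine_hull_eq)
  qed
  moreover have "affine hull F \<subseteq> {x. a \<bullet> x = c}"
    by (intro hull_minimal affine_hyperplane) (auto simp: F_def)
  ultimately have hull: "affine hull F = {x. a \<bullet> x = c}"
    using hull_mono by blast
  then have "aff_dim F = DIM('a) - 1"
    using a aff_dim_eq_hyperplane by blast
  moreover have "aff_dim (closure C) = DIM('a)"
    using chamber_open chamber_nonempty by (simp add: aff_dim_open)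
  moreover have "q \<in> F"
    using assms(2,3) a by (simp add: F_def hyperplane_reflection_fixed_iff)
  ultimately have "F \<in> facets (closure C)"
    using face by (auto simp: facets_def facet_of_def of_nat_diff Suc_leI)
  moreover have "is_reflection_in r (affine hull F)"
    unfolding is_reflection_in_def hull using a by blast
  ultimately show thesis
    by (rule that)
qed

text \<open>Since \<open>regular_points\<close> is open, the mirror points of the segment form a
  compact set, so one of them is nearest to \<open>x\<close>. The segment before it is connected to
  \<open>x\<close> off the mirrors and hence in \<open>C\<close>, which puts \<open>q\<close> in the
  closure.\<close>

lemma first_wall_on_segment:
  assumes "x \<in> C" "s \<in> R" "z \<in> closed_segment x y" "s z = z"
  obtains r q where "r \<in> R" "q \<in> closed_segment x y" "r q = q" "q \<in> closure C"
    "\<And>s z. s \<in> R \<Longrightarrow> z \<in> closed_segment x y \<Longrightarrow> s z = z \<Longrightarrow> dist x q \<le> dist x z"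
proof -
  define Z where "Z = closed_segment x y - regular_points"
  have "compact Z"
    unfolding Z_def by (intro compact_diff compact_segment open_regular_points)
  moreover have "z \<in> Z"
    using assms by (auto simp: Z_def regular_points_def)
  ultimately obtain q where "q \<in> Z" and min: "\<And>w. w \<in> Z \<Longrightarrow> dist x q \<le> dist x w"
    using distance_attains_inf[of Z x] by (metis compact_imp_closed empty_iff)
  then obtain r where r: "r \<in> R" "q \<in> closed_segment x y" "r q = q"
    by (auto simp: Z_def regular_points_def)
  have "open_segment x q \<subseteq> C"
  proof
    fix w
    assume w: "w \<in> open_segment x q"
    have "closed_segment x w \<subseteq> C"
    proof (rule connected_subset_chamber)
      show "closed_segment x w \<inter> C \<noteq> {}"
        using assms(1) by auto
      fix t u
      assume t: "t \<in> R" and u: "u \<in> closed_segment x w"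
      have "dist x u \<le> dist x w"
        using dist_in_closed_segment[OF u] by (simp add: dist_commute)
      also have "dist x w < dist x q"
        using dist_in_open_segment[OF w] by (simp add: dist_commute)
      finally have "u \<notin> Z"
        using min by (meson not_le)
      moreover have "closed_segment x w \<subseteq> closed_segment x y"
      proof -
        have "closed_segment x q \<subseteq> closed_segment x y"
          using r(2) by (simp add: closed_segment_subset)
        then have "w \<in> closed_segment x y"
          using w by (auto simp: open_segment_def)
        then show ?thesis
          by (simp add: closed_segment_subset)
      qed
      ultimately show "t u \<noteq> u"
        using t u by (auto simp: Z_def regular_points_def)
    qed simp
    then show "w \<in> C"
      by auto
  qed
  moreover have "x \<noteq> q"
    using assms(1) r chamber_regular by blast
  ultimately have "q \<in> closure C"
    using closure_mono[of "open_segment x q" C] by auto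
  with r show thesis
    by (intro that[of r q]) (auto intro!: min simp: Z_def regular_points_def)
qed

end

end

subsection \<open>Facet normals and component groups\<close>

text \<open>If \<open>D\<close> had points strictly on both sides of the hyperplane spanned by
  \<open>F\<close>, the segment between them would cross \<open>F\<close> in its interior, and the
  face property would force its ends into \<open>F\<close>.\<close>

lemma facet_supporting_hyperplane:
  fixes D :: "'a::euclidean_space set"
  assumes "convex D" "interior D \<noteq> {}" "F facet_of D"
  obtains a c where "norm a = 1" "affine hull F = {x. a \<bullet> x = c}" "D \<subseteq> {x. a \<bullet> x \<le> c}"
    "F = D \<inter> {x. a \<bullet> x = c}"
proof -
  have face: "F face_of D" and "F \<noteq> {}"
    using assms(3) by (auto simp: facet_of_def)
  have "aff_dim F = DIM('a) - 1"
    using assms by (simp add: facet_of_def aff_dim_nonempty_interior)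
  then obtain b d where b: "b \<noteq> 0" "affine hull F = {x. b \<bullet> x = d}"
    using aff_dim_eq_hyperplane by blast
  have F: "F = D \<inter> {x. b \<bullet> x = d}"
    using face_of_imp_eq_affine_Int[OF assms(1) face] b(2) by (simp add: Int_commute)
  have no_crossing: "\<not> (b \<bullet> u < d \<and> d < b \<bullet> v)" if uv: "u \<in> D" "v \<in> D" for u v
  proof
    assume lt: "b \<bullet> u < d \<and> d < b \<bullet> v"
    then obtain z where z: "z \<in> closed_segment u v" "b \<bullet> z = d"
      using connected_ivt_hyperplane[of "closed_segment u v" u v b d] by auto
    then have "z \<in> D"
      using assms(1) uv by (meson convex_contains_segment subsetD)
    then have "z \<in> F"
      using F z by blast
    moreover have "z \<in> open_segment u v"
      using z lt by (auto simp: open_segment_def)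
    ultimately have "u \<in> F"
      using face uv unfolding face_of_def by blast
    then show False
      using F lt by auto
  qed
  \<comment> \<open>This normalises \<open>b\<close> and chooses the sign that puts \<open>D\<close>
    on the lower side: if some point of \<open>D\<close> is above the hyperplane,
    \<open>no_crossing\<close> leaves none below.\<close>
  define k where "k = (if D \<subseteq> {x. b \<bullet> x \<le> d} then 1 / norm b else - 1 / norm b)"
  have k: "k \<noteq> 0" "norm (k *\<^sub>R b) = 1"
    using b(1) by (auto simp: k_def)
  then have eq: "{x. (k *\<^sub>R b) \<bullet> x = k * d} = {x. b \<bullet> x = d}"
    by auto
  have "D \<subseteq> {x. (k *\<^sub>R b) \<bullet> x \<le> k * d}"
  proof (cases "D \<subseteq> {x. b \<bullet> x \<le> d}")
    case True
    then show ?thesis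
      using b(1) by (auto simp: k_def divide_right_mono)
  next
    case False
    then obtain v where v: "v \<in> D" "\<not> b \<bullet> v \<le> d"
      by blast
    have "d \<le> b \<bullet> u" if "u \<in> D" for u
      using no_crossing[OF that v(1)] v(2) by linarith
    then show ?thesis
      using False b(1) by (auto simp: k_def divide_right_mono)
  qed
  then show thesis
    using k eq F b(2) by (intro that[of "k *\<^sub>R b" "k * d"]) simp_all
qed

text \<open>A competing normal \<open>b\<close> defines a hyperplane through \<open>F\<close> of the
  same dimension, so \<open>b\<close> is \<open>a\<close> or \<open>- a\<close>. The second choice
  would confine \<open>D\<close> to a hyperplane, against its nonempty interior.\<close>

lemma outward_normal_facet:
  fixes D :: "'a::euclidean_space set"
  assumes "convex D" "interior D \<noteq> {}" "F facet_of D"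
  obtains c where "norm (outward_normal D F) = 1"
    "affine hull F = {x. outward_normal D F \<bullet> x = c}"
proof -
  obtain a c where a: "norm a = 1" and hull: "affine hull F = {x. a \<bullet> x = c}"
    and D: "D \<subseteq> {x. a \<bullet> x \<le> c}" and F: "F = D \<inter> {x. a \<bullet> x = c}"
    using facet_supporting_hyperplane[OF assms] by metis
  have "outward_normal D F = a"
    unfolding outward_normal_def
  proof (rule the_equality)
    show "norm a = 1 \<and> (\<exists>c. D \<subseteq> {x. a \<bullet> x \<le> c} \<and> F = D \<inter> {x. a \<bullet> x = c})"
      using a D F by blast
  next
    fix b
    assume "norm b = 1 \<and> (\<exists>d. D \<subseteq> {x. b \<bullet> x \<le> d} \<and> F = D \<inter> {x. b \<bullet> x = d})"
    then obtain d where b: "norm b = 1" "D \<subseteq> {x. b \<bullet> x \<le> d}" "F = D \<inter> {x. b \<bullet> x = d}"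
      by blast
    have nz: "a \<noteq> 0" "b \<noteq> 0"
      using a b by auto
    have "affine hull F \<subseteq> {x. b \<bullet> x = d}"
      using b(3) by (intro hull_minimal affine_hyperplane) auto
    then have sub: "{x. a \<bullet> x = c} \<subseteq> {x. b \<bullet> x = d}"
      by (simp add: hull)
    have ne: "{x. a \<bullet> x = c} \<noteq> {}"
      using assms(3) hull by (auto simp: facet_of_def)
    have "aff_dim {x. a \<bullet> x = c} = aff_dim {x. b \<bullet> x = d}"
      using nz by simp
    with sub ne have "{x. a \<bullet> x = c} = {x. b \<bullet> x = d}"
      by (intro affine_dim_equal affine_hyperplane)
    then obtain k where k: "b = k *\<^sub>R a" "d = k * c"
      using hyperplane_eq_imp_proportional nz by metis
    with a b have "\<bar>k\<bar> = 1"
      by simp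
    moreover have "k \<noteq> -1"
    proof
      assume "k = -1"
      then have "D \<subseteq> {x. a \<bullet> x = c}"
        using D b(2) k by fastforce
      then have "interior D \<subseteq> {}"
        using interior_mono[of D "{x. a \<bullet> x = c}"] nz by simp
      with assms(2) show False
        by simp
    qed
    ultimately have "k = 1"
      by linarith
    with k show "b = a"
      by simp
  qed
  with a hull show thesis
    by (intro that) auto
qed

lemma facet_reflection_normal:
  fixes D :: "'a::euclidean_space set"
  assumes "convex D" "interior D \<noteq> {}" "F facet_of D" "is_reflection_in r (affine hull F)"
  obtains c where "r = hyperplane_reflection (outward_normal D F) c"
proof -
  obtain c where c: "norm (outward_normal D F) = 1"
    "affine hull F = {x. outward_normal D F \<bullet> x = c}"
    using outward_normal_facet[OF assms(1-3)] by metis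
  then have "outward_normal D F \<noteq> 0"
    by auto
  with c have "is_reflection_in (hyperplane_reflection (outward_normal D F) c) (affine hull F)"
    unfolding is_reflection_in_def by blast
  with assms(4) that show thesis
    using is_reflection_in_unique by metis
qed

lemma diagram_component_subset:
  assumes "\<C> \<in> diagram_components D"
  shows "\<C> \<subseteq> facets D"
proof -
  have "(F, F') \<in> (coxeter_edges D)\<^sup>* \<Longrightarrow> F \<in> facets D \<Longrightarrow> F' \<in> facets D" for F F'
    by (induction rule: rtrancl_induct) (auto simp: coxeter_edges_def)
  with assms show ?thesis
    by (auto simp: diagram_components_def quotient_def)
qed

lemma diagram_component_nonempty: "\<C> \<in> diagram_components D \<Longrightarrow> \<C> \<noteq> {}"
  by (auto simp: diagram_components_def quotient_def)

lemma facet_in_diagram_component: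
  assumes "F \<in> facets D"
  obtains \<C> where "\<C> \<in> diagram_components D" "F \<in> \<C>"
  using assms by (intro that[of "(coxeter_edges D)\<^sup>* `` {F}"])
    (auto simp: diagram_components_def quotient_def)

lemma sym_coxeter_edges: "sym (coxeter_edges D)"
proof (rule symI)
  have "adjacent_facets D F F' = adjacent_facets D F' F"
    "dihedral_angle D F F' = dihedral_angle D F' F" for F F'
    by (auto simp: adjacent_facets_def dihedral_angle_def Int_commute inner_commute)
  then show "(F, F') \<in> coxeter_edges D \<Longrightarrow> (F', F) \<in> coxeter_edges D" for F F'
    by (auto simp: coxeter_edges_def)
qed

lemma distinct_diagram_components_no_edge:
  assumes "\<C> \<in> diagram_components D" "\<C>' \<in> diagram_components D" "\<C> \<noteq> \<C>'"
    and "F \<in> \<C>" "F' \<in> \<C>'"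
  shows "(F, F') \<notin> (coxeter_edges D)\<^sup>*"
proof
  let ?E = "(coxeter_edges D)\<^sup>*"
  assume "(F, F') \<in> ?E"
  have sym: "(u, v) \<in> ?E \<Longrightarrow> (v, u) \<in> ?E" for u v
    using sym_rtrancl[OF sym_coxeter_edges] by (meson symD)
  obtain A B where A: "\<C> = ?E `` {A}" and B: "\<C>' = ?E `` {B}"
    using assms(1,2) by (auto simp: diagram_components_def quotient_def)
  then have "(A, F) \<in> ?E" "(B, F') \<in> ?E"
    using assms(4,5) by auto
  with \<open>(F, F') \<in> ?E\<close> have "(A, B) \<in> ?E"
    by (meson rtrancl_trans sym)
  then have "\<C> = \<C>'"
    unfolding A B by (auto intro: rtrancl_trans sym)
  with assms(3) show False ..
qed

lemma distinct_diagram_components_orthogonal: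
  fixes D :: "'a::euclidean_space set"
  assumes "convex D" "interior D \<noteq> {}"
    and "\<C> \<in> diagram_components D" "\<C>' \<in> diagram_components D" "\<C> \<noteq> \<C>'"
    and "F \<in> \<C>" "F' \<in> \<C>'"
  shows "outward_normal D F \<bullet> outward_normal D F' = 0"
proof -
  have "(F, F') \<notin> (coxeter_edges D)\<^sup>*"
    using distinct_diagram_components_no_edge assms(3-7) by blast
  then have "F \<noteq> F'" "(F, F') \<notin> coxeter_edges D"
    by auto
  moreover have F: "F \<in> facets D" "F' \<in> facets D"
    using assms(3-7) diagram_component_subset by blast+
  ultimately have "arccos (outward_normal D F \<bullet> outward_normal D F') = pi / 2"
    by (auto simp: coxeter_edges_def dihedral_angle_def)
  moreover have "norm (outward_normal D F) = 1" "norm (outward_normal D F') = 1"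
    using F outward_normal_facet[OF assms(1,2)] unfolding facets_def by (metis mem_Collect_eq)+
  \<comment> \<open>\<open>cos\<close> undoes \<open>arccos\<close> only on arguments of absolute
    value at most 1, which unit normals guarantee.\<close>
  then have "\<bar>outward_normal D F \<bullet> outward_normal D F'\<bar> \<le> 1"
    using Cauchy_Schwarz_ineq2[of "outward_normal D F" "outward_normal D F'"] by simp
  then have "cos (arccos (outward_normal D F \<bullet> outward_normal D F'))
      = outward_normal D F \<bullet> outward_normal D F'"
    by (simp add: cos_arccos_abs)
  ultimately show ?thesis
    by (metis cos_pi_half)
qed

definition normal_space :: "'a::euclidean_space set \<Rightarrow> 'a set set \<Rightarrow> 'a set"
  where "normal_space D \<F> = span (outward_normal D ` \<F>)"

lemma normal_space_orthogonal:
  fixes D :: "'a::euclidean_space set"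
  assumes "convex D" "interior D \<noteq> {}"
    and "\<C> \<in> diagram_components D" "\<C>' \<in> diagram_components D" "\<C> \<noteq> \<C>'"
    and "v \<in> normal_space D \<C>" "w \<in> normal_space D \<C>'"
  shows "v \<bullet> w = 0"
proof -
  have "orthogonal x w" if "x \<in> outward_normal D ` \<C>" for x
    using assms(7) unfolding normal_space_def
    by (rule orthogonal_to_span)
      (use that distinct_diagram_components_orthogonal[OF assms(1-5)] in \<open>auto simp: orthogonal_def\<close>)
  then have "orthogonal w v"
    using assms(6) unfolding normal_space_def
    by (intro orthogonal_to_span[of v]) (auto simp: orthogonal_commute)
  then show ?thesis
    by (simp add: orthogonal_def inner_commute)
qed

text \<open>One facet chosen from each component yields nonzero, pairwise orthogonal normals. These
  are linearly independent, so the dimension bounds their number.\<close>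

lemma finite_diagram_components:
  fixes D :: "'a::euclidean_space set"
  assumes "convex D" "interior D \<noteq> {}"
  shows "finite (diagram_components D)"
proof -
  have "\<forall>\<C>\<in>diagram_components D. \<exists>F. F \<in> \<C>"
    using diagram_component_nonempty by blast
  then obtain rep where rep: "\<And>\<C>. \<C> \<in> diagram_components D \<Longrightarrow> rep \<C> \<in> \<C>"
    by metis
  define n where "n \<C> = outward_normal D (rep \<C>)" for \<C>
  have orth: "n \<C> \<bullet> n \<C>' = 0"
    if "\<C> \<in> diagram_components D" "\<C>' \<in> diagram_components D" "\<C> \<noteq> \<C>'" for \<C> \<C>'
    unfolding n_def using distinct_diagram_components_orthogonal[OF assms that] rep that by blast
  have nz: "n \<C> \<noteq> 0" if "\<C> \<in> diagram_components D" for \<C>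
  proof -
    have "rep \<C> facet_of D"
      using rep[OF that] diagram_component_subset[OF that] by (auto simp: facets_def)
    then have "norm (n \<C>) = 1"
      unfolding n_def using outward_normal_facet[OF assms] by metis
    then show ?thesis
      by auto
  qed
  have "pairwise orthogonal (n ` diagram_components D)" "0 \<notin> n ` diagram_components D"
    using orth nz by (auto simp: pairwise_def orthogonal_def)
  then have "finite (n ` diagram_components D)"
    using pairwise_orthogonal_independent independent_imp_finite by blast
  moreover have "inj_on n (diagram_components D)"
    using orth nz by (intro inj_onI) (metis inner_eq_zero_iff)
  ultimately show ?thesis
    by (rule finite_imageD)
qed

section \<open>Motions along a subspace\<close>

text \<open>For a subspace \<open>V\<close> these are the bijections that act on the
  \<open>V\<close> coordinate alone in the splitting of the space into \<open>V\<close> and its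
  orthogonal complement; the conditions express this without projections.\<close>

definition moves_within :: "'a::euclidean_space set \<Rightarrow> ('a \<Rightarrow> 'a) set"
  where "moves_within V = {g. bij g \<and> (\<forall>x. g x - x \<in> V) \<and>
    (\<forall>x v. (\<forall>w\<in>V. v \<bullet> w = 0) \<longrightarrow> g (x + v) = g x + v)}"

lemma subgroup_moves_within:
  assumes V: "subspace V"
  shows "subgroup (moves_within V) transformations"
proof (rule group.subgroupI[OF group_transformations])
  show "moves_within V \<subseteq> carrier transformations"
    by (auto simp: moves_within_def)
  have "id \<in> moves_within V"
    using subspace_0[OF V] by (simp add: moves_within_def)
  then show "moves_within V \<noteq> {}"
    by blast
next
  fix g
  assume g: "g \<in> moves_within V"
  then have b: "bij g"
    by (simp add: moves_within_def)
  let ?h = "Hilbert_Choice.inv g"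
  have gh: "g (?h x) = x" for x
    using b by (simp add: bij_is_surj surj_f_inv_f)
  have hg: "?h (g x) = x" for x
    using b by (simp add: bij_is_inj)
  have "?h x - x \<in> V" for x
  proof -
    have "g (?h x) - ?h x \<in> V"
      using g by (simp add: moves_within_def)
    then show ?thesis
      using subspace_neg[OF V] gh by fastforce
  qed
  moreover have "?h (x + v) = ?h x + v" if "\<forall>w\<in>V. v \<bullet> w = 0" for x v
  proof -
    have "g (?h x + v) = x + v"
      using g that gh by (simp add: moves_within_def)
    then show ?thesis
      using hg by metis
  qed
  ultimately have "?h \<in> moves_within V"
    using b by (simp add: moves_within_def bij_imp_bij_inv)
  then show "inv\<^bsub>transformations\<^esub> g \<in> moves_within V"
    by (simp add: inv_transformations b)
next
  fix g h
  assume gh: "g \<in> moves_within V" "h \<in> moves_within V"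
  have "g (h x) - x \<in> V" for x
  proof -
    have "(g (h x) - h x) + (h x - x) \<in> V"
      using gh by (intro subspace_add[OF V]) (auto simp: moves_within_def)
    then show ?thesis
      by simp
  qed
  with gh have "g \<circ> h \<in> moves_within V"
    by (auto simp: moves_within_def bij_comp)
  then show "g \<otimes>\<^bsub>transformations\<^esub> h \<in> moves_within V"
    using gh by (simp add: moves_within_def)
qed

lemma hyperplane_reflection_moves_within:
  assumes "subspace V" "a \<in> V" "a \<noteq> 0"
  shows "hyperplane_reflection a c \<in> moves_within V"
proof -
  have "hyperplane_reflection a c x - x \<in> V" for x
    using subspace_scale[OF assms(1,2), of "- (2 * (a \<bullet> x - c) / (a \<bullet> a))"]
    by (simp add: hyperplane_reflection_def)
  moreover have "hyperplane_reflection a c (x + v) = hyperplane_reflection a c x + v"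
    if "\<forall>w\<in>V. v \<bullet> w = 0" for x v
    using that assms(2) by (simp add: hyperplane_reflection_def inner_add_right inner_commute)
  ultimately show ?thesis
    using bij_is_reflection[OF is_reflection_hyperplane_reflection[OF assms(3)]]
    by (auto simp: moves_within_def)
qed

text \<open>The displacement \<open>h x - x\<close> is orthogonal to \<open>V\<close>, so
  \<open>g\<close> carries it along unchanged. Both compositions thus send \<open>x\<close> to
  \<open>g x + h x - x\<close>.\<close>

lemma moves_within_commute:
  assumes "g \<in> moves_within V" "h \<in> moves_within W" "\<And>v w. v \<in> V \<Longrightarrow> w \<in> W \<Longrightarrow> v \<bullet> w = 0"
  shows "g \<circ> h = h \<circ> g"
proof
  fix x
  have "h x - x \<in> W" "g x - x \<in> V"
    using assms(1,2) by (auto simp: moves_within_def)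
  then have "\<forall>v\<in>V. (h x - x) \<bullet> v = 0" "\<forall>w\<in>W. (g x - x) \<bullet> w = 0"
    using assms(3) by (metis inner_commute)+
  then have "g (x + (h x - x)) = g x + (h x - x)" "h (x + (g x - x)) = h x + (g x - x)"
    using assms(1,2) by (auto simp only: moves_within_def mem_Collect_eq)
  then show "(g \<circ> h) x = (h \<circ> g) x"
    by (simp add: algebra_simps) (metis add_left_cancel)
qed

lemma component_group_moves_within:
  fixes D :: "'a::euclidean_space set"
  assumes "convex D" "interior D \<noteq> {}" "\<F> \<subseteq> facets D"
  shows "component_group \<F> \<subseteq> moves_within (normal_space D \<F>)"
  unfolding component_group_def
proof (rule group.generate_subgroup_incl[OF group_transformations])
  show "subgroup (moves_within (normal_space D \<F>)) transformations"
    by (simp add: subgroup_moves_within normal_space_def)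
  show "facet_reflections \<F> \<subseteq> moves_within (normal_space D \<F>)"
  proof
    fix r
    assume "r \<in> facet_reflections \<F>"
    then obtain F where F: "F \<in> \<F>" "is_reflection_in r (affine hull F)"
      by (auto simp: facet_reflections_def)
    then have facet: "F facet_of D"
      using assms(3) by (auto simp: facets_def)
    obtain c where "r = hyperplane_reflection (outward_normal D F) c"
      using facet_reflection_normal[OF assms(1,2) facet F(2)] by metis
    moreover have "outward_normal D F \<noteq> 0"
      using outward_normal_facet[OF assms(1,2) facet] by (metis norm_zero zero_neq_one)
    moreover have "outward_normal D F \<in> normal_space D \<F>"
      using F by (simp add: normal_space_def span_base)
    ultimately show "r \<in> moves_within (normal_space D \<F>)"
      by (simp add: hyperplane_reflection_moves_within normal_space_def)
  qed
qed

lemma is_reflection_facet_reflections: "r \<in> facet_reflections \<F> \<Longrightarrow> is_reflection r"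
  unfolding facet_reflections_def is_reflection_def by blast

lemma subgroup_component_group: "subgroup (component_group \<F>) transformations"
  unfolding component_group_def
  by (rule subgroup_generate_reflections) (rule is_reflection_facet_reflections)

lemma component_groups_commute:
  fixes D :: "'a::euclidean_space set"
  assumes "convex D" "interior D \<noteq> {}"
    and "\<C> \<in> diagram_components D" "\<C>' \<in> diagram_components D" "\<C> \<noteq> \<C>'"
    and "g \<in> component_group \<C>" "h \<in> component_group \<C>'"
  shows "g \<circ> h = h \<circ> g"
proof (rule moves_within_commute)
  show "g \<in> moves_within (normal_space D \<C>)"
    using component_group_moves_within[OF assms(1,2) diagram_component_subset[OF assms(3)]] assms(6)
    by blast
  show "h \<in> moves_within (normal_space D \<C>')"
    using component_group_moves_within[OF assms(1,2) diagram_component_subset[OF assms(4)]] assms(7)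
    by blast
qed (rule normal_space_orthogonal[OF assms(1-5)])

subsection \<open>Every reflection lies in a component group\<close>

context reflection_arrangement
begin

context
  fixes C :: "'a set"
  assumes C: "C \<in> components regular_points"
begin

lemma convex_closure_chamber: "convex (closure C)"
  using chamber_convex[OF C] by (rule convex_closure)

lemma interior_closure_chamber: "interior (closure C) \<noteq> {}"
  using interior_mono[OF closure_subset[of C]] chamber_open[OF C] chamber_nonempty[OF C]
  by (auto simp: interior_open)

lemma wall_component_group:
  assumes "r \<in> R" "q \<in> closure C" "r q = q" "\<And>s. s \<in> R \<Longrightarrow> s q = q \<Longrightarrow> s = r"
  obtains \<C> where "\<C> \<in> diagram_components (closure C)" "r \<in> component_group \<C>"
proof -
  obtain F where F: "F \<in> facets (closure C)" "is_reflection_in r (affine hull F)"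
    using wall_facet[OF C assms] by metis
  obtain \<C> where \<C>: "\<C> \<in> diagram_components (closure C)" "F \<in> \<C>"
    using F(1) by (rule facet_in_diagram_component)
  with F have "r \<in> facet_reflections \<C>"
    by (auto simp: facet_reflections_def)
  then have "r \<in> component_group \<C>"
    unfolding component_group_def by (rule generate.incl)
  with \<C>(1) show thesis
    by (rule that)
qed

text \<open>If the two components agree, \<open>r\<close> is a product of elements of that one
  group. If they differ, \<open>s\<close> commutes with \<open>s \<circ> r \<circ> s\<close>, which
  makes \<open>r\<close> equal to this conjugate.\<close>

lemma conjugate_component_group:
  assumes \<C>: "\<C> \<in> diagram_components (closure C)" "s \<in> component_group \<C>"
    and "s \<in> R" "\<C>' \<in> diagram_components (closure C)" "s \<circ> r \<circ> s \<in> component_group \<C>'"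
  obtains \<C>'' where "\<C>'' \<in> diagram_components (closure C)" "r \<in> component_group \<C>''"
proof -
  have r: "r = s \<circ> (s \<circ> r \<circ> s) \<circ> s"
    using is_reflection_conjugate_twice[OF reflection[OF assms(3)]] by simp
  show thesis
  proof (cases "\<C> = \<C>'")
    case True
    then have "r \<in> component_group \<C>"
      using \<C>(2) assms(5) subgroup_transformations_comp[OF subgroup_component_group]
      by (subst r) blast
    with \<C>(1) show thesis
      by (rule that)
  next
    case False
    then have "s \<circ> (s \<circ> r \<circ> s) = (s \<circ> r \<circ> s) \<circ> s"
      using component_groups_commute[OF convex_closure_chamber interior_closure_chamber] assms
      by blast
    then have "r = (s \<circ> r \<circ> s) \<circ> (s \<circ> s)"
      using r by (simp add: comp_assoc)
    then have "r = s \<circ> r \<circ> s"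
      using is_reflection_comp_self[OF reflection[OF assms(3)]] by simp
    with assms(4,5) show thesis
      using that by simp
  qed
qed

text \<open>Segment and reflection both vary in the induction, as the hypothesis is applied to the
  reflected rest of the segment and to \<open>s \<circ> r \<circ> s\<close>. The chamber is fixed,
  so every step refers to the same diagram.\<close>

lemma reflection_crossing_segment:
  assumes "x \<in> C"
    and "\<And>r s z. r \<in> R \<Longrightarrow> s \<in> R \<Longrightarrow> z \<in> closed_segment x y \<Longrightarrow> r z = z \<Longrightarrow> s z = z \<Longrightarrow> r = s"
    and "r \<in> R" "z \<in> closed_segment x y" "r z = z"
  shows "\<exists>\<C>\<in>diagram_components (closure C). r \<in> component_group \<C>"
  using assms
proof (induction "card {r \<in> R. \<exists>z\<in>closed_segment x y. r z = z}" arbitrary: x y r z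
    rule: less_induct)
  case less
  define X where "X = {r \<in> R. \<exists>z\<in>closed_segment x y. r z = z}"
  have fin: "finite X"
    unfolding X_def by (intro locally_finite compact_segment)
  obtain s q where s: "s \<in> R" "s q = q" and q: "q \<in> closed_segment x y" "q \<in> closure C"
    and first: "\<And>t w. t \<in> R \<Longrightarrow> w \<in> closed_segment x y \<Longrightarrow> t w = w \<Longrightarrow> dist x q \<le> dist x w"
    using first_wall_on_segment[OF C less.prems(1,3,4,5)] by metis
  have only: "t = s" if "t \<in> R" "t q = q" for t
    using less.prems(2)[OF that(1) s(1) q(1) that(2) s(2)] .
  obtain \<C> where \<C>: "\<C> \<in> diagram_components (closure C)" "s \<in> component_group \<C>"
    using wall_component_group[OF s(1) q(2) s(2) only] by metis
  show ?case
  proof (cases "r = s")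
    case True
    with \<C> show ?thesis
      by blast
  next
    case False
    obtain a c e where a: "a \<noteq> 0" "s = hyperplane_reflection a c"
      and side: "\<And>x. x \<in> C \<Longrightarrow> a \<bullet> x < c" and "e > 0"
      and half_ball: "ball q e \<inter> {x. a \<bullet> x < c} \<subseteq> C"
      using chamber_near_wall[OF C s(1) q(2) s(2) only] by metis
    define p where "p t = x + t *\<^sub>R (y - x)" for t
    have seg: "w \<in> closed_segment x y \<longleftrightarrow> (\<exists>t. 0 \<le> t \<and> t \<le> 1 \<and> w = p t)" for w
      by (auto simp: closed_segment_def p_def algebra_simps)
    have dist_p: "dist x (p t) = \<bar>t\<bar> * norm (y - x)" for t
      by (simp add: p_def dist_norm)
    obtain t0 where t0: "0 \<le> t0" "t0 \<le> 1" "q = p t0"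
      using q seg by blast
    obtain t1 where t1: "0 \<le> t1" "t1 \<le> 1" "z = p t1"
      using less.prems(4) seg by blast
    \<comment> \<open>By genericity \<open>q\<close> lies only on the mirror of \<open>s\<close>, so
      the mirror of \<open>r\<close> is met strictly later; this gives
      \<open>t0 < t1\<close>.\<close>
    have "z \<noteq> q"
      using only False less.prems(3,5) by blast
    have "x \<noteq> y"
      using \<open>z \<noteq> q\<close> q less.prems(4) by auto
    then have "t0 \<le> t1"
      using first[OF less.prems(3-5)] t0 t1 by (simp add: dist_p)
    with \<open>z \<noteq> q\<close> t0 t1 have "t0 < t1"
      by (cases "t0 = t1") auto
    define k where "k = a \<bullet> (y - x)"
    have ap: "a \<bullet> p t = a \<bullet> x + t * k" for t
      by (simp add: p_def k_def inner_add_right)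
    have aq: "a \<bullet> x + t0 * k = c"
      using s(2) a t0 ap by (simp add: hyperplane_reflection_fixed_iff)
    then have "t0 * k > 0"
      using side[OF less.prems(1)] by simp
    then have "k > 0"
      using t0 by (simp add: zero_less_mult_iff)
    \<comment> \<open>The new start lies just past the first wall: within \<open>e / 2\<close> of
      \<open>q\<close>, so that its reflection falls into the half-ball, but no later than
      \<open>t1\<close>, so that \<open>z\<close> remains on the rest of the segment.\<close>
    define u where "u = min t1 (t0 + e / (2 * norm (y - x)))"
    have u: "t0 < u" "u \<le> t1"
      using \<open>t0 < t1\<close> \<open>e > 0\<close> \<open>x \<noteq> y\<close> by (auto simp: u_def)
    have "dist q (p u) < e"
    proof -
      have "q - p u = (t0 - u) *\<^sub>R (y - x)"
        by (simp add: t0 p_def algebra_simps)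
      then have "dist q (p u) = (u - t0) * norm (y - x)"
        using u by (simp add: dist_norm)
      also have "\<dots> \<le> e / (2 * norm (y - x)) * norm (y - x)"
        by (intro mult_right_mono) (auto simp: u_def)
      also have "\<dots> < e"
        using \<open>e > 0\<close> \<open>x \<noteq> y\<close> by simp
      finally show ?thesis .
    qed
    have beyond: "c < a \<bullet> p t" if "u \<le> t" for t
    proof -
      have "t0 * k < t * k"
        using u that \<open>k > 0\<close> by simp
      then show ?thesis
        using aq ap by simp
    qed
    \<comment> \<open>\<open>s\<close> fixes \<open>q\<close>, hence preserves the distance to
      \<open>q\<close>, and it takes the far side of the wall to the side of
      \<open>C\<close>.\<close>
    have "s (p u) \<in> C"
    proof -
      have "dist q (s (p u)) < e"
        using \<open>dist q (p u) < e\<close> dist_is_reflection[OF reflection[OF s(1)], of q "p u"] s(2)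
        by simp
      moreover have "a \<bullet> s (p u) < c"
        using beyond[of u] a by (simp add: hyperplane_reflection_inner_self)
      ultimately show ?thesis
        using half_ball by auto
    qed
    have seg': "w \<in> closed_segment (p u) y \<Longrightarrow> \<exists>t. u \<le> t \<and> t \<le> 1 \<and> w = p t" for w
    proof -
      assume "w \<in> closed_segment (p u) y"
      then obtain l where l: "0 \<le> l" "l \<le> 1" "w = (1 - l) *\<^sub>R p u + l *\<^sub>R y"
        by (auto simp: closed_segment_def)
      have "w = p (u + l * (1 - u))"
        by (simp add: l p_def algebra_simps)
      moreover have "u \<le> u + l * (1 - u)"
        using l u t1 by simp
      moreover have "u + l * (1 - u) \<le> 1"
        using mult_right_mono[of l 1 "1 - u"] l u t1 by simp
      ultimately show ?thesis
        by blast
    qed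
    have sub: "closed_segment (p u) y \<subseteq> closed_segment x y"
    proof (rule closed_segment_subset)
      show "p u \<in> closed_segment x y"
        unfolding seg using u t0 t1 by (intro exI[of _ u]) auto
    qed simp_all
    have not_s: "s w \<noteq> w" if w: "w \<in> closed_segment (p u) y" for w
    proof -
      obtain t where "u \<le> t" "w = p t"
        using seg'[OF w] by blast
      with beyond[of t] a show ?thesis
        by (simp add: hyperplane_reflection_fixed_iff)
    qed
    have image: "closed_segment (s (p u)) (s y) = s ` closed_segment (p u) y"
      by (rule closed_segment_is_reflection[OF reflection[OF s(1)]])
    have conj_fixed: "(s \<circ> t \<circ> s) w = w \<longleftrightarrow> t (s w) = s w" for t w
      using is_reflection_involutive[OF reflection[OF s(1)]] by (metis comp_apply)
    \<comment> \<open>Conjugation by \<open>s\<close> injects the mirrors met by the reflected rest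
      into those met by the original segment. It never yields \<open>s\<close> itself, as the rest
      lies strictly beyond that wall; so the count drops.\<close>
    define Y where "Y = {t \<in> R. \<exists>w\<in>closed_segment (s (p u)) (s y). t w = w}"
    have "inj_on (\<lambda>t. s \<circ> t \<circ> s) Y"
      by (rule inj_onI)
        (metis is_reflection_conjugate_twice reflection s(1))
    moreover have "(\<lambda>t. s \<circ> t \<circ> s) ` Y \<subseteq> X - {s}"
    proof
      fix t'
      assume "t' \<in> (\<lambda>t. s \<circ> t \<circ> s) ` Y"
      then obtain t w where t: "t \<in> R" "w \<in> closed_segment (p u) y" "t (s w) = s w"
        and t': "t' = s \<circ> t \<circ> s"
        unfolding Y_def image by blast
      then have "t' w = w" "t' \<in> R"
        unfolding t' using conj_fixed conjugate s(1) by blast+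
      with t(2) sub not_s show "t' \<in> X - {s}"
        unfolding X_def by blast
    qed
    ultimately have "card Y \<le> card (X - {s})"
      using fin by (metis card_inj_on_le finite_Diff)
    also have "\<dots> < card X"
      using fin s q by (intro card_Diff1_less) (auto simp: X_def)
    finally have card: "card Y < card X" .
    have "\<exists>\<C>\<in>diagram_components (closure C). s \<circ> r \<circ> s \<in> component_group \<C>"
    proof (rule less.hyps[OF card[unfolded X_def Y_def]])
      show "s (p u) \<in> C"
        by fact
      \<comment> \<open>Genericity survives the reflection: the conjugates of \<open>r1\<close> and
        \<open>r2\<close> fix a common point of the original segment, so they agree.\<close>
      show "r1 = r2" if r12: "r1 \<in> R" "r2 \<in> R" "w \<in> closed_segment (s (p u)) (s y)"
        "r1 w = w" "r2 w = w" for r1 r2 w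
      proof -
        obtain v where v: "v \<in> closed_segment (p u) y" "w = s v"
          using r12(3) image by blast
        have "(s \<circ> r1 \<circ> s) v = v" "(s \<circ> r2 \<circ> s) v = v"
          using r12(4,5) v(2) conj_fixed by blast+
        then have "s \<circ> r1 \<circ> s = s \<circ> r2 \<circ> s"
          using less.prems(2) conjugate[OF r12(1) s(1)] conjugate[OF r12(2) s(1)] v(1) sub
          by blast
        then show ?thesis
          by (metis is_reflection_conjugate_twice reflection s(1))
      qed
      show "s \<circ> r \<circ> s \<in> R"
        using conjugate less.prems(3) s(1) by blast
      have "z \<in> closed_segment (p u) y"
      \<comment> \<open>The position of \<open>z\<close> on the rest is found by dividing by
        \<open>1 - u\<close>. If \<open>u = 1\<close>, then also \<open>t1 = 1\<close> and
        \<open>z\<close> is the start \<open>p u\<close>.\<close>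
      proof (cases "u = 1")
        case True
        then show ?thesis
          using u t1 by simp
      next
        case False
        define l where "l = (t1 - u) / (1 - u)"
        have "u < 1"
          using False u t1 by simp
        then have "0 \<le> l" "l \<le> 1" "u + l * (1 - u) = t1"
          using u t1 by (simp_all add: l_def)
        moreover have "(1 - l) *\<^sub>R p u + l *\<^sub>R y = p (u + l * (1 - u))"
          by (simp add: p_def algebra_simps)
        ultimately show ?thesis
          using t1 by (auto simp: closed_segment_def intro!: exI[of _ l])
      qed
      then show "s z \<in> closed_segment (s (p u)) (s y)"
        using image by blast
      show "(s \<circ> r \<circ> s) (s z) = s z"
        using less.prems(5) conjugate_image_fixed_iff[OF s(1)] by blast
    qed
    then show ?thesis
      using conjugate_component_group[OF \<C> s(1)] by metis
  qed
qed

lemma reflection_in_component_group: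
  assumes "r \<in> R"
  shows "\<exists>\<C>\<in>diagram_components (closure C). r \<in> component_group \<C>"
proof -
  obtain x0 where "x0 \<in> C"
    using chamber_nonempty[OF C] by blast
  \<comment> \<open>The end \<open>y\<close> lies beyond the mirror of \<open>r\<close> and on no
    mirror, because a reflection fixing it would have a conjugate fixing \<open>x0\<close>. The
    start is chosen afresh afterwards, since genericity depends on \<open>y\<close>.\<close>
  define y where "y = r x0"
  obtain a c where a: "a \<noteq> 0" "r = hyperplane_reflection a c"
    and side: "\<And>x. x \<in> C \<Longrightarrow> a \<bullet> x < c"
    using chamber_side[OF C assms] by metis
  have "y \<in> regular_points"
    unfolding regular_points_def
  proof (intro CollectI ballI notI)
    fix s
    assume "s \<in> R" "s y = y"
    then have "(r \<circ> s \<circ> r) x0 = x0"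
      using is_reflection_involutive[OF reflection[OF assms]] by (simp add: y_def)
    then show False
      using chamber_regular[OF C \<open>x0 \<in> C\<close>] conjugate \<open>s \<in> R\<close> assms by blast
  qed
  then obtain x where "x \<in> C" and generic:
    "\<And>r s z. r \<in> R \<Longrightarrow> s \<in> R \<Longrightarrow> z \<in> closed_segment x y \<Longrightarrow> r z = z \<Longrightarrow> s z = z \<Longrightarrow> r = s"
    using generic_segment_start[OF chamber_open[OF C] chamber_nonempty[OF C]] by metis
  have "a \<bullet> x \<le> c" "c \<le> a \<bullet> y"
    using side[OF \<open>x \<in> C\<close>] side[OF \<open>x0 \<in> C\<close>] a
    by (simp_all add: y_def hyperplane_reflection_inner_self)
  then obtain z where z: "z \<in> closed_segment x y" "a \<bullet> z = c"
    using connected_ivt_hyperplane[of "closed_segment x y" x y a c] by auto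
  then have "r z = z"
    using a by (simp add: hyperplane_reflection_fixed_iff)
  show ?thesis
  proof (rule reflection_crossing_segment)
    show "r \<in> R" "x \<in> C" "z \<in> closed_segment x y" "r z = z"
      by fact+
  qed (rule generic)
qed

end

end

subsection \<open>Products of orthogonal motions\<close>

text \<open>
  If each \<open>f i\<close> moves points within \<open>V i\<close>, with the \<open>V i\<close> pairwise orthogonal, this is the composition
  of all \<open>f i\<close> in any order.
\<close>

definition combined_motion ::
    "'i set \<Rightarrow> ('i \<Rightarrow> 'a \<Rightarrow> 'a) \<Rightarrow> 'a::euclidean_space \<Rightarrow> 'a"
  where "combined_motion I f x = x + (\<Sum>i\<in>I. f i x - x)"

locale orthogonal_motions =
  fixes I :: "'i set" and V :: "'i \<Rightarrow> 'a::euclidean_space set"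
  assumes finite_index: "finite I"
    and subspace: "i \<in> I \<Longrightarrow> subspace (V i)"
    and orthogonal: "i \<in> I \<Longrightarrow> j \<in> I \<Longrightarrow> i \<noteq> j \<Longrightarrow> v \<in> V i \<Longrightarrow> w \<in> V j \<Longrightarrow> v \<bullet> w = 0"
begin

lemma displacement:
  assumes "i \<in> I" "\<And>i. i \<in> I \<Longrightarrow> f i \<in> moves_within (V i)"
  shows "f i x - x \<in> V i"
  using assms by (auto simp: moves_within_def)

lemma orthogonal_displacement_sum:
  assumes "\<And>i. i \<in> I \<Longrightarrow> f i \<in> moves_within (V i)" "i \<in> I" "w \<in> V i"
  shows "(\<Sum>j\<in>I - {i}. f j x - x) \<bullet> w = 0"
  unfolding inner_sum_left
proof (rule sum.neutral, rule ballI)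
  fix j
  assume "j \<in> I - {i}"
  then show "(f j x - x) \<bullet> w = 0"
    using assms displacement[of j f x] orthogonal by blast
qed

text \<open>The combined motion moves \<open>x\<close> to \<open>g i x\<close> plus displacements
  orthogonal to \<open>V i\<close>, and \<open>f i\<close> commutes with translation by
  these.\<close>

lemma combined_motion_apply:
  assumes f: "\<And>i. i \<in> I \<Longrightarrow> f i \<in> moves_within (V i)"
    and g: "\<And>i. i \<in> I \<Longrightarrow> g i \<in> moves_within (V i)" and "i \<in> I"
  shows "f i (combined_motion I g x) - combined_motion I g x = f i (g i x) - g i x"
proof -
  let ?v = "\<Sum>j\<in>I - {i}. g j x - x"
  have "combined_motion I g x = g i x + ?v"
    using sum.remove[OF finite_index assms(3), of "\<lambda>j. g j x - x"]
    by (simp add: combined_motion_def)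
  moreover have "f i (g i x + ?v) = f i (g i x) + ?v"
    using f[OF assms(3)] orthogonal_displacement_sum[OF g assms(3)] by (simp add: moves_within_def)
  ultimately show ?thesis
    by simp
qed

lemma combined_motion_comp:
  assumes "\<And>i. i \<in> I \<Longrightarrow> f i \<in> moves_within (V i)" "\<And>i. i \<in> I \<Longrightarrow> g i \<in> moves_within (V i)"
  shows "combined_motion I (\<lambda>i\<in>I. f i \<circ> g i) = combined_motion I f \<circ> combined_motion I g"
proof
  fix x
  have "(combined_motion I f \<circ> combined_motion I g) x
      = combined_motion I g x + (\<Sum>i\<in>I. f i (g i x) - g i x)"
    using combined_motion_apply[OF assms]
    by (simp add: combined_motion_def[of I f] cong: sum.cong)
  also have "\<dots> = x + (\<Sum>i\<in>I. (g i x - x) + (f i (g i x) - g i x))"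
    by (simp only: combined_motion_def sum.distrib add.assoc)
  also have "\<dots> = combined_motion I (\<lambda>i\<in>I. f i \<circ> g i) x"
    by (simp add: combined_motion_def cong: sum.cong)
  finally show "combined_motion I (\<lambda>i\<in>I. f i \<circ> g i) x
      = (combined_motion I f \<circ> combined_motion I g) x" ..
qed

text \<open>The differences \<open>d j\<close> lie in pairwise orthogonal subspaces and sum to zero;
  the inner product with \<open>d i\<close> isolates \<open>d i \<bullet> d i\<close>.\<close>

lemma combined_motion_inj:
  assumes f: "\<And>i. i \<in> I \<Longrightarrow> f i \<in> moves_within (V i)"
    and g: "\<And>i. i \<in> I \<Longrightarrow> g i \<in> moves_within (V i)"
    and eq: "combined_motion I f = combined_motion I g" and "i \<in> I"
  shows "f i = g i"
proof
  fix x
  define d where "d j = f j x - g j x" for j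
  have d: "d j \<in> V j" if "j \<in> I" for j
  proof -
    have "(f j x - x) - (g j x - x) \<in> V j"
      using displacement[of j f, OF that f] displacement[of j g, OF that g] subspace_diff[OF subspace[OF that]]
      by blast
    then show ?thesis
      by (simp add: d_def)
  qed
  have "(\<Sum>j\<in>I. d j) = (\<Sum>j\<in>I. f j x - x) - (\<Sum>j\<in>I. g j x - x)"
    unfolding sum_subtractf[symmetric] by (simp add: d_def)
  also have "\<dots> = 0"
    using fun_cong[OF eq, of x] by (simp add: combined_motion_def)
  finally have "(\<Sum>j\<in>I. d j \<bullet> d i) = 0"
    by (simp flip: inner_sum_left)
  moreover have "(\<Sum>j\<in>I. d j \<bullet> d i) = d i \<bullet> d i + (\<Sum>j\<in>I - {i}. d j \<bullet> d i)"
    by (rule sum.remove[OF finite_index assms(4)])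
  moreover have "(\<Sum>j\<in>I - {i}. d j \<bullet> d i) = 0"
  proof (rule sum.neutral, rule ballI)
    fix j
    assume "j \<in> I - {i}"
    then show "d j \<bullet> d i = 0"
      using d assms(4) orthogonal[of j i "d j" "d i"] by simp
  qed
  ultimately have "d i = 0"
    by simp
  then show "f i x = g i x"
    by (simp add: d_def)
qed

lemma combined_motion_single:
  assumes "i \<in> I"
  shows "combined_motion I (\<lambda>j\<in>I. if j = i then g else id) = g"
proof
  fix x
  have "(\<Sum>j\<in>I. (\<lambda>j\<in>I. if j = i then g else id) j x - x) = (\<Sum>j\<in>I. if j = i then g x - x else 0)"
    by (intro sum.cong) auto
  then show "combined_motion I (\<lambda>j\<in>I. if j = i then g else id) x = g x"
    using assms finite_index by (simp add: combined_motion_def)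
qed

lemma combined_motion_id: "combined_motion I (\<lambda>j\<in>I. id) = id"
  by (auto simp: combined_motion_def fun_eq_iff intro: sum.neutral)

lemma combined_motion_mem:
  assumes H: "subgroup H transformations" and K: "\<And>i. i \<in> I \<Longrightarrow> K i \<subseteq> H"
    and moves: "\<And>i. i \<in> I \<Longrightarrow> K i \<subseteq> moves_within (V i)"
    and id: "\<And>i. i \<in> I \<Longrightarrow> id \<in> K i"
    and f: "\<And>i. i \<in> I \<Longrightarrow> f i \<in> K i"
  shows "combined_motion I f \<in> H"
proof -
  \<comment> \<open>The factors are switched on one at a time, with \<open>id\<close> as the value
    outside \<open>J\<close>; each step composes with a motion that has a single nontrivial
    factor.\<close>
  have "combined_motion I (\<lambda>j\<in>I. if j \<in> J then f j else id) \<in> H" if "J \<subseteq> I" for J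
    using finite_subset[OF that finite_index] that
  proof (induction J rule: finite_induct)
    case empty
    then show ?case
      using subgroup_transformations_id[OF H]
      by (simp only: empty_iff if_False combined_motion_id)
  next
    case (insert i J)
    let ?f = "\<lambda>j\<in>I. if j = i then f i else id" and ?g = "\<lambda>j\<in>I. if j \<in> J then f j else id"
    have comp: "combined_motion I (\<lambda>j\<in>I. ?f j \<circ> ?g j) = combined_motion I ?f \<circ> combined_motion I ?g"
      using insert.prems f id moves by (intro combined_motion_comp) (auto split: if_splits)
    have restr: "(\<lambda>j\<in>I. ?f j \<circ> ?g j) = (\<lambda>j\<in>I. if j \<in> insert i J then f j else id)"
      using insert.hyps by (auto simp: fun_eq_iff)
    have "combined_motion I ?f \<in> H"
      using insert.prems f K by (subst combined_motion_single) auto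
    moreover have "combined_motion I ?g \<in> H"
      using insert.prems by (intro insert.IH) simp
    ultimately have "combined_motion I ?f \<circ> combined_motion I ?g \<in> H"
      by (rule subgroup_transformations_comp[OF H])
    then show ?case
      unfolding comp[symmetric] restr .
  qed
  from this[of I] have "combined_motion I (\<lambda>j\<in>I. if j \<in> I then f j else id) \<in> H"
    by simp
  also have "combined_motion I (\<lambda>j\<in>I. if j \<in> I then f j else id) = combined_motion I f"
    by (simp add: combined_motion_def fun_eq_iff cong: sum.cong)
  finally show ?thesis .
qed

text \<open>The isomorphism is \<open>combined_motion\<close>. Its image contains every
  \<open>K i\<close> and is closed under products, so it exhausts the generated group; inverses of
  generators lie in the same \<open>K i\<close>.\<close>

lemma direct_product_of_generated:
  assumes K: "\<And>i. i \<in> I \<Longrightarrow> subgroup (K i) transformations"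
    and moves: "\<And>i. i \<in> I \<Longrightarrow> K i \<subseteq> moves_within (V i)"
  shows "direct_product_of transformations (generate transformations (\<Union>(K ` I))) I K"
proof -
  define H where "H = generate transformations (\<Union>(K ` I))"
  let ?P = "product_group I (\<lambda>i. transformations\<lparr>carrier := K i\<rparr>)"
  let ?\<phi> = "combined_motion I"
  have bij: "bij g" if "g \<in> K i" "i \<in> I" for g i
    using subgroup_transformations_bij[OF K] that by blast
  have H: "subgroup H transformations"
    unfolding H_def by (intro group.generate_is_subgroup[OF group_transformations]) (auto intro: bij)
  have KH: "K i \<subseteq> H" if "i \<in> I" for i
    unfolding H_def using that by (auto intro: generate.incl)
  have id: "id \<in> K i" if "i \<in> I" for i
    using subgroup_transformations_id[OF K[OF that]] .
  have single: "(\<lambda>j\<in>I. if j = i then g else id) \<in> Pi\<^sub>E I K" if "i \<in> I" "g \<in> K i" for i g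
    using that id by auto
  have in_H: "?\<phi> f \<in> H" if "f \<in> Pi\<^sub>E I K" for f
    using that by (intro combined_motion_mem[OF H KH moves id]) auto
  have mult: "f \<otimes>\<^bsub>?P\<^esub> g = (\<lambda>i\<in>I. f i \<circ> g i)" if "f \<in> Pi\<^sub>E I K" "g \<in> Pi\<^sub>E I K" for f g
  proof -
    have "f i \<otimes>\<^bsub>transformations\<^esub> g i = f i \<circ> g i" if "i \<in> I" for i
      using that bij[OF PiE_mem[OF \<open>f \<in> Pi\<^sub>E I K\<close>]] bij[OF PiE_mem[OF \<open>g \<in> Pi\<^sub>E I K\<close>]]
      by simp
    then show ?thesis
      by (simp cong: restrict_cong)
  qed
  have comp: "?\<phi> (\<lambda>i\<in>I. f i \<circ> g i) = ?\<phi> f \<circ> ?\<phi> g" if "f \<in> Pi\<^sub>E I K" "g \<in> Pi\<^sub>E I K" for f g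
    using that moves by (intro combined_motion_comp) (auto simp: PiE_iff)
  have "?\<phi> \<in> hom ?P (transformations\<lparr>carrier := H\<rparr>)"
  proof (rule homI)
    show "?\<phi> f \<in> carrier (transformations\<lparr>carrier := H\<rparr>)" if "f \<in> carrier ?P" for f
      using that in_H by simp
    show "?\<phi> (f \<otimes>\<^bsub>?P\<^esub> g) = ?\<phi> f \<otimes>\<^bsub>transformations\<lparr>carrier := H\<rparr>\<^esub> ?\<phi> g"
      if "f \<in> carrier ?P" "g \<in> carrier ?P" for f g
    proof -
      have fg: "f \<in> Pi\<^sub>E I K" "g \<in> Pi\<^sub>E I K"
        using that by simp_all
      then have "bij (?\<phi> f)" "bij (?\<phi> g)"
        using in_H subgroup_transformations_bij[OF H] by blast+
      then show ?thesis
        using comp[OF fg] by (simp only: mult[OF fg]) simp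
    qed
  qed
  moreover have "inj_on ?\<phi> (Pi\<^sub>E I K)"
  proof (rule inj_onI)
    fix f g
    assume fg: "f \<in> Pi\<^sub>E I K" "g \<in> Pi\<^sub>E I K" "?\<phi> f = ?\<phi> g"
    have mf: "\<And>i. i \<in> I \<Longrightarrow> f i \<in> moves_within (V i)" "\<And>i. i \<in> I \<Longrightarrow> g i \<in> moves_within (V i)"
      using fg moves by (auto simp: PiE_iff)
    show "f = g"
      by (rule PiE_ext[OF fg(1,2)]) (rule combined_motion_inj[OF mf fg(3)])
  qed
  moreover have "?\<phi> ` Pi\<^sub>E I K = H"
  proof
    show "?\<phi> ` Pi\<^sub>E I K \<subseteq> H"
      using in_H by blast
    show "H \<subseteq> ?\<phi> ` Pi\<^sub>E I K"
    proof
      fix h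
      assume "h \<in> H"
      then show "h \<in> ?\<phi> ` Pi\<^sub>E I K"
        unfolding H_def
      proof (induction rule: generate.induct)
        case one
        have "(\<lambda>j\<in>I. id) \<in> Pi\<^sub>E I K"
          using id by auto
        then show ?case
          using combined_motion_id by (metis image_eqI one_transformations)
      next
        case (incl h)
        then obtain i where "i \<in> I" "h \<in> K i"
          by blast
        then show ?case
          using single combined_motion_single by (metis image_eqI)
      next
        case (inv h)
        then obtain i where i: "i \<in> I" "h \<in> K i"
          by blast
        then have "inv\<^bsub>transformations\<^esub> h \<in> K i"
          using subgroup.m_inv_closed[OF K] by blast
        with i(1) show ?case
          using single combined_motion_single by (metis image_eqI)
      next
        case (eng h1 h2)
        then obtain f1 f2 where f: "f1 \<in> Pi\<^sub>E I K" "h1 = ?\<phi> f1" "f2 \<in> Pi\<^sub>E I K" "h2 = ?\<phi> f2"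
          by blast
        then have "bij h1" "bij h2"
          using in_H subgroup_transformations_bij[OF H] by blast+
        then have "h1 \<otimes>\<^bsub>transformations\<^esub> h2 = ?\<phi> (\<lambda>i\<in>I. f1 i \<circ> f2 i)"
          using comp f by simp
        moreover have "(\<lambda>i\<in>I. f1 i \<circ> f2 i) \<in> Pi\<^sub>E I K"
          using f subgroup_transformations_comp[OF K] by (auto simp: PiE_iff)
        ultimately show ?case
          by blast
      qed
    qed
  qed
  ultimately have "?\<phi> \<in> iso ?P (transformations\<lparr>carrier := H\<rparr>)"
    by (simp add: iso_def bij_betw_def)
  moreover have "?\<phi> (\<lambda>j\<in>I. if j = i then g else \<one>\<^bsub>transformations\<^esub>) = g" if "i \<in> I" for i g
    unfolding one_transformations by (rule combined_motion_single[OF that])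
  ultimately show ?thesis
    unfolding direct_product_of_def H_def[symmetric] by blast
qed

end

section \<open>Reflection groups as arrangements, and the splitting of subgroups\<close>

lemma reflection_group_subgroup:
  assumes "reflection_group G"
  shows "subgroup G transformations"
proof (cases "euclidean_reflection_group G")
  case True
  then obtain P where "G = component_group (facets P)"
    by (auto simp: euclidean_reflection_group_def component_group_def)
  then show ?thesis
    by (simp add: subgroup_component_group)
next
  case False
  then obtain R where "\<And>r. r \<in> R \<Longrightarrow> is_reflection r" "G = generate transformations R"
    using assms
    by (auto simp: reflection_group_def spherical_reflection_group_def generated_by_reflections_def)
  then show ?thesis
    by (simp add: subgroup_generate_reflections)
qed

text \<open>For finite \<open>G\<close> local finiteness is immediate; an infinite \<open>G\<close>
  cannot be spherical and is therefore discrete.\<close>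

lemma reflection_arrangement_reflection_group:
  fixes G :: "('a::euclidean_space \<Rightarrow> 'a) set"
  assumes "reflection_group G"
  shows "reflection_arrangement {r \<in> G. is_reflection r}"
proof
  note G = reflection_group_subgroup[OF assms]
  show "is_reflection r" if "r \<in> {r \<in> G. is_reflection r}" for r
    using that by simp
  show "s \<circ> r \<circ> s \<in> {r \<in> G. is_reflection r}"
    if "r \<in> {r \<in> G. is_reflection r}" "s \<in> {r \<in> G. is_reflection r}" for r s
    using that subgroup_transformations_comp[OF G] is_reflection_conjugate by auto
  show "finite {r \<in> {r \<in> G. is_reflection r}. \<exists>z\<in>K. r z = z}" if "compact K" for K
  proof (cases "finite G")
    case True
    then show ?thesis
      by (rule rev_finite_subset) auto
  next
    case False
    then have "discrete_group G"
      using assms by (auto simp: reflection_group_def spherical_reflection_group_def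
          euclidean_reflection_group_def)
    from discrete_group_locally_finite_reflections[OF G this that] show ?thesis
      by (rule rev_finite_subset) auto
  qed
qed

text \<open>This identifies the open chambers of \<open>G\<close> with the components of
  \<open>regular_points\<close>, to which the results on arrangements apply.\<close>

lemma complement_mirrors:
  fixes G :: "('a::euclidean_space \<Rightarrow> 'a) set"
  shows "- \<Union>(mirrors G) = {x. \<forall>r\<in>{r \<in> G. is_reflection r}. r x \<noteq> x}"
proof -
  have "x \<in> \<Union>(mirrors G) \<longleftrightarrow> (\<exists>r\<in>{r \<in> G. is_reflection r}. r x = x)" for x
  proof
    assume "x \<in> \<Union>(mirrors G)"
    then obtain r M where "r \<in> G" "is_reflection_in r M" "x \<in> M"
      by (auto simp: mirrors_def)
    then show "\<exists>r\<in>{r \<in> G. is_reflection r}. r x = x"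
      using is_reflection_in_fixed_points unfolding is_reflection_def by blast
  next
    assume "\<exists>r\<in>{r \<in> G. is_reflection r}. r x = x"
    then show "x \<in> \<Union>(mirrors G)"
      using is_reflection_in_fixed unfolding mirrors_def by blast
  qed
  then show ?thesis
    by blast
qed

theorem lemma1:
  fixes G H :: "('a::euclidean_space \<Rightarrow> 'a) set" and D :: "'a set"
  assumes "reflection_group G"
    and "\<not> indecomposable G"
    and "fundamental_chamber G D"
    and "reflection_subgroup H G"
  shows "\<exists>K. (\<forall>\<C>\<in>diagram_components D. reflection_subgroup (K \<C>) (component_group \<C>)) \<and>
             direct_product_of transformations H (diagram_components D) K"
proof -
  define R where "R = {r \<in> G. is_reflection r}"
  interpret reflection_arrangement R
    unfolding R_def by (rule reflection_arrangement_reflection_group[OF assms(1)])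
  have "- \<Union>(mirrors G) = regular_points"
    unfolding complement_mirrors regular_points_def by (simp add: R_def)
  then obtain C where C: "C \<in> components regular_points" and D: "D = closure C"
    using assms(3) by (auto simp: fundamental_chamber_def)
  have convex: "convex D" and interior: "interior D \<noteq> {}"
    using convex_closure_chamber[OF C] interior_closure_chamber[OF C] by (simp_all add: D)
  interpret orthogonal_motions "diagram_components D" "normal_space D"
    using finite_diagram_components[OF convex interior] normal_space_orthogonal[OF convex interior]
    by unfold_locales (simp_all add: normal_space_def)
  obtain S where S: "\<And>r. r \<in> S \<Longrightarrow> is_reflection r" and H: "H = generate transformations S"
    and "H \<subseteq> G"
    using assms(4) unfolding reflection_subgroup_def generated_by_reflections_def by blast
  have subgroup_H: "subgroup H transformations"
    unfolding H using S by (rule subgroup_generate_reflections)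
  have "S \<subseteq> H"
    unfolding H by (auto intro: generate.incl)
  \<comment> \<open>Sorting the generators of \<open>H\<close>, rather than intersecting
    \<open>H\<close> itself with the component group, makes \<open>K \<C>\<close> generated by
    reflections by construction.\<close>
  define T where "T \<C> = S \<inter> component_group \<C>" for \<C> :: "'a set set"
  define K where "K \<C> = generate transformations (T \<C>)" for \<C> :: "'a set set"
  have subgroup_K: "subgroup (K \<C>) transformations" for \<C>
    unfolding K_def using S by (intro subgroup_generate_reflections) (auto simp: T_def)
  have K_sub: "K \<C> \<subseteq> component_group \<C>" for \<C>
    unfolding K_def
    by (rule group.generate_subgroup_incl[OF group_transformations _ subgroup_component_group])
      (simp add: T_def)
  have "reflection_subgroup (K \<C>) (component_group \<C>)" for \<C>
  proof -
    have "generated_by_reflections (K \<C>)"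
      unfolding generated_by_reflections_def K_def
      by (rule exI[of _ "T \<C>"]) (simp add: T_def S)
    then show ?thesis
      using subgroup_K K_sub by (simp add: reflection_subgroup_def)
  qed
  moreover have "H = generate transformations (\<Union>(K ` diagram_components D))"
  proof
    \<comment> \<open>This is where the generators must be reflections: an arbitrary element of
      \<open>G\<close> may have nontrivial parts in several components.\<close>
    have "r \<in> \<Union>(K ` diagram_components D)" if "r \<in> S" for r
    proof -
      have "r \<in> R"
        using that S \<open>S \<subseteq> H\<close> \<open>H \<subseteq> G\<close> by (auto simp: R_def)
      then obtain \<C> where "\<C> \<in> diagram_components D" "r \<in> component_group \<C>"
        using reflection_in_component_group[OF C] D by blast
      moreover from this that have "r \<in> K \<C>"
        unfolding K_def T_def by (intro generate.incl) simp
      ultimately show ?thesis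
        by blast
    qed
    then show "H \<subseteq> generate transformations (\<Union>(K ` diagram_components D))"
      unfolding H by (intro group.mono_generate[OF group_transformations]) blast
    have "K \<C> \<subseteq> H" for \<C>
      unfolding K_def H by (rule group.mono_generate[OF group_transformations]) (simp add: T_def)
    then show "generate transformations (\<Union>(K ` diagram_components D)) \<subseteq> H"
      by (intro group.generate_subgroup_incl[OF group_transformations _ subgroup_H]) blast
  qed
  moreover have "direct_product_of transformations
      (generate transformations (\<Union>(K ` diagram_components D))) (diagram_components D) K"
  proof (rule direct_product_of_generated[OF subgroup_K])
    show "K \<C> \<subseteq> moves_within (normal_space D \<C>)" if "\<C> \<in> diagram_components D" for \<C>
      using K_sub component_group_moves_within[OF convex interior diagram_component_subset[OF that]]
      by blast
  qed
  ultimately show ?thesis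
    by auto
qed

end
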